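(* For any real $B>1$, let $$A(B):=\{x\in\mathbb I: a_n(x)\ge B^n\ \text{for infinitely many } n\in\mathbb N\}.$$ Then $$\dim_{\rm H}A(B)=\theta(\log B),$$ where $\theta(\log B)$ denotes the unique solution $\theta\in(1/2,\infty)$ of $\mathrm P(\theta)=\theta\log B$.
   Context: $\mathbb N=\{1,2,3,\dots\}$ and $\mathbb I:=[0,1)\setminus\mathbb Q$. For $x\in\mathbb I$, $a_1(x),a_2(x),\dots\in\mathbb N$ are the coefficients (partial quotients) of its continued fraction expansion $x=[a_1(x),a_2(x),\dots]=1/(a_1(x)+1/(a_2(x)+\cdots))$. For positive integers $a_1,\dots,a_n$, $q_n(a_1,\dots,a_n)$ is the denominator (in lowest terms) of the rational number $[a_1,\dots,a_n]=1/(a_1+1/(a_2+\cdots+1/a_n))$. The Diophantine pressure function is $$\mathrm P(\theta):=\lim_{n\to\infty}\frac1n\log\sum_{a_1,\dots,a_n\in\mathbb N}q_n(a_1,\dots,a_n)^{-2\theta},\qquad \theta>\tfrac12.$$ $\dim_{\rm H}$ denotes Hausdorff dimension. *)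

theory Defs
  imports "HOL-Analysis.Analysis"
begin

section \<open>Hausdorff dimension\<close>

text \<open>
  The gauge \<open>(diam U)\<^sup>s\<close>, with the usual conventions for \<open>s = 0\<close>: nonempty sets have gauge 1, so
  that the 0-dimensional Hausdorff measure is counting measure (\<open>0 powr 0 = 0\<close> would spoil this).
\<close>
definition diam_pow :: "real \<Rightarrow> 'a::metric_space set \<Rightarrow> real" where
  "diam_pow s U = (if U = {} then 0 else if s = 0 then 1 else diameter U powr s)"

text \<open>Boundedness is demanded because \<^const>\<open>diameter\<close> is unspecified on unbounded sets.\<close>
definition hausdorff_content :: "real \<Rightarrow> real \<Rightarrow> 'a::metric_space set \<Rightarrow> ennreal" where
  "hausdorff_content s \<delta> A =
     Inf {(\<Sum>i. ennreal (diam_pow s (U i))) | U :: nat \<Rightarrow> 'a set.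
            A \<subseteq> (\<Union>i. U i) \<and> (\<forall>i. bounded (U i) \<and> diameter (U i) \<le> \<delta>)}"

definition hausdorff_outer_measure :: "real \<Rightarrow> 'a::metric_space set \<Rightarrow> ennreal" where
  "hausdorff_outer_measure s A = (SUP \<delta>\<in>{0<..}. hausdorff_content s \<delta> A)"

definition hausdorff_dim :: "'a::metric_space set \<Rightarrow> ereal" where
  "hausdorff_dim A = Inf {ereal s | s. 0 \<le> s \<and> hausdorff_outer_measure s A = 0}"

section \<open>Continued fractions\<close>

definition irrational_unit :: "real set" where
  "irrational_unit = {0..<1} - \<rat>"

definition gauss_map :: "real \<Rightarrow> real" where
  "gauss_map x = frac (1 / x)"

text \<open>The \<open>n\<close>-th partial quotient of \<open>x\<close>; indices start at \<open>n = 1\<close>.\<close>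
definition partial_quotient :: "nat \<Rightarrow> real \<Rightarrow> nat" where
  "partial_quotient n x = nat \<lfloor>1 / (gauss_map ^^ (n - 1)) x\<rfloor>"

text \<open>\<open>cfrac [a\<^sub>1, \<dots>, a\<^sub>n] = 1 / (a\<^sub>1 + 1 / (a\<^sub>2 + \<dots> + 1 / a\<^sub>n))\<close>\<close>
primrec cfrac :: "nat list \<Rightarrow> rat" where
  "cfrac [] = 0"
| "cfrac (a # as) = 1 / (of_nat a + cfrac as)"

text \<open>\<^const>\<open>quotient_of\<close> returns numerator and positive denominator in lowest terms.\<close>
definition cf_denom :: "nat list \<Rightarrow> int" where
  "cf_denom as = snd (quotient_of (cfrac as))"

definition pos_tuples :: "nat \<Rightarrow> nat list set" where
  "pos_tuples n = {as. length as = n \<and> (\<forall>a\<in>set as. 1 \<le> a)}"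

definition pressure :: "real \<Rightarrow> real" where
  "pressure \<theta> =
     lim (\<lambda>n. 1 / real n * ln (\<Sum>\<^sub>\<infinity>as\<in>pos_tuples n. of_int (cf_denom as) powr (- 2 * \<theta>)))"

definition large_quotient_set :: "real \<Rightarrow> real set" where
  "large_quotient_set B =
     {x \<in> irrational_unit. infinite {n. 1 \<le> n \<and> real (partial_quotient n x) \<ge> B ^ n}}"

subsection \<open>The partial quotients form the continued fraction expansion\<close>

lemma irrational_unit_pos: "x \<in> irrational_unit \<Longrightarrow> 0 < x \<and> x < 1"
  by (cases "x = 0") (auto simp: irrational_unit_def)

lemma gauss_map_irrational_unit:
  assumes "x \<in> irrational_unit"
  shows "gauss_map x \<in> irrational_unit"
proof -
  have "frac (1 / x) \<notin> \<rat>"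
  proof
    assume "frac (1 / x) \<in> \<rat>"
    hence "frac (1 / x) + of_int \<lfloor>1 / x\<rfloor> \<in> \<rat>"
      by (intro Rats_add) auto
    hence "1 / x \<in> \<rat>"
      by (simp add: frac_def)
    hence "inverse (1 / x) \<in> \<rat>"
      by (rule Rats_inverse)
    thus False
      using assms by (simp add: irrational_unit_def)
  qed
  thus ?thesis
    by (simp add: irrational_unit_def gauss_map_def frac_ge_0 frac_lt_1)
qed

lemma gauss_map_funpow_irrational_unit:
  "x \<in> irrational_unit \<Longrightarrow> (gauss_map ^^ n) x \<in> irrational_unit"
  by (induction n) (auto intro: gauss_map_irrational_unit)

lemma partial_quotient_ge_1:
  assumes "x \<in> irrational_unit"
  shows "1 \<le> partial_quotient n x"
proof -
  have "1 \<le> 1 / (gauss_map ^^ (n - 1)) x"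
    using irrational_unit_pos[OF gauss_map_funpow_irrational_unit[OF assms, of "n - 1"]]
    by simp
  hence "1 \<le> \<lfloor>1 / (gauss_map ^^ (n - 1)) x\<rfloor>"
    by (simp add: le_floor_iff)
  thus ?thesis
    unfolding partial_quotient_def by linarith
qed

text \<open>\<open>x = 1 / (a\<^sub>1 + 1 / (a\<^sub>2 + \<dots> + 1 / (a\<^sub>n + t)))\<close> with remainder \<open>t\<close> again in \<open>irrational_unit\<close>.\<close>
lemma partial_quotient_expansion:
  assumes "x \<in> irrational_unit"
  shows "x = foldr (\<lambda>k t. 1 / (real (partial_quotient k x) + t)) [1..<Suc n] ((gauss_map ^^ n) x)"
proof (induction n)
  case 0
  show ?case by simp
next
  case (Suc n)
  let ?y = "(gauss_map ^^ n) x"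
  have y: "0 < ?y" "?y < 1"
    using irrational_unit_pos[OF gauss_map_funpow_irrational_unit[OF assms]] by auto
  have "real (partial_quotient (Suc n) x) = of_int \<lfloor>1 / ?y\<rfloor>"
    using y by (simp add: partial_quotient_def)
  hence "1 / (real (partial_quotient (Suc n) x) + gauss_map ?y) = ?y"
    by (simp add: gauss_map_def frac_def)
  thus ?case
    using Suc.IH by simp
qed

end

theory Submission
  imports Defs "HOL-Probability.Infinite_Product_Measure"
begin

text \<open>
  Let \<open>M\<^sub>a\<close> be the inverse branch of the \<open>n\<close>-th iterate of the Gauss map that belongs to the partial
  quotients \<open>a = (a\<^sub>1, \<dots>, a\<^sub>n)\<close>, and \<open>q\<^sub>a\<close> the denominator of \<open>[a\<^sub>1, \<dots>, a\<^sub>n]\<close>. The set \<open>A(B)\<close> is a limsup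
  set: up to rounding, it consists of the irrational \<open>x\<close> that are, for infinitely many \<open>n\<close>, of the form
  \<open>M\<^sub>a t\<close> with a tuple \<open>a\<close> of length \<open>n\<close> and \<open>0 \<le> t \<le> B\<^sup>-\<^sup>(\<^sup>n\<^sup>+\<^sup>1\<^sup>)\<close>. Since \<open>M\<^sub>a\<close> contracts distances by a factor between \<open>1 / (4 q\<^sub>a\<^sup>2)\<close> and \<open>1 / q\<^sub>a\<^sup>2\<close>, these
  pieces have diameter about \<open>B\<^sup>-\<^sup>n q\<^sub>a\<^sup>-\<^sup>2\<close>, and the sum of their \<open>\<theta>\<close>-th powers over all \<open>a\<close> of length \<open>n\<close>
  grows like \<open>exp (n (P(\<theta>) - \<theta> log B))\<close>. The dimension is the exponent at which this rate vanishes.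

  \<^emph>\<open>The root.\<close> Continuants are multiplicative under concatenation up to a factor 2, so the logarithms
  of the denominator sums are subadditive and Fekete's lemma gives the limit \<open>P\<close>
  (\<open>pressure_limit\<close>). It is nonincreasing, so \<open>P(\<theta>) - \<theta> log B\<close> is strictly decreasing; by Hoelder's
  inequality it is convex, hence continuous. It is large near \<open>1/2\<close>, where the harmonic series
  appears, and \<open>P(1) \<le> 0\<close> because the cylinders of order \<open>n\<close> are disjoint subintervals of \<open>[0, 1]\<close>. Thus
  there is exactly one root, and it is at most 1.

  \<^emph>\<open>Upper bound.\<close> Above the root the sums decay geometrically, and the natural covers show that the
  Hausdorff measure vanishes (\<open>hausdorff_outer_measure_large_quotient_set_eq_0\<close>).

  \<^emph>\<open>Lower bound.\<close> Below the root, at exponent \<open>s\<close>, a Cantor subset of \<open>A(B)\<close> is coded by sequences of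
  words. On a free level the word comes from a finite set \<open>W\<close> of \<open>m\<close>-tuples for which
  \<open>Z = \<Sum> q\<^sub>w\<^sup>-\<^sup>2\<^sup>s\<close> exceeds \<open>B\<^sup>s\<^sup>m\<close> by as large a factor as needed; the rare big levels contain one
  quotient from an interval \<open>[\<beta>, 2\<beta>)\<close> with \<open>\<beta> \<ge> B\<^sup>n\<close>. The codes carry a product measure: proportional to
  \<open>q\<^sub>w\<^sup>-\<^sup>2\<^sup>s\<close> on free levels, uniform on big ones. The number \<open>budget\<close> bounds (mass of a cylinder) \<open>\<times> q\<^sup>2\<^sup>s\<close>.
  It shrinks by a factor of more than \<open>B\<^sup>s\<^sup>(\<^sup>m\<^sup>+\<^sup>1\<^sup>)\<close> on a free level, and a level is made big as soon as the budget has
  dropped below \<open>\<beta>\<^sup>-\<^sup>s\<close>, which is what a big level costs. Looking at the first level on which the codes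
  of the points of a set \<open>U\<close> differ, one finds that they have mass at most \<open>K (diam U)\<^sup>s\<close>
  (\<open>codes_in_set_small\<close>), and the mass distribution principle gives positive \<open>s\<close>-dimensional measure.
\<close>

section \<open>Continuants\<close>

text \<open>
  The matrix \<open>[[prev_num, cnum], [prev_den, cden]]\<close> is the product of the matrices \<open>[[0, 1], [1, a]]\<close>:
  \<open>cnum / cden\<close> is the last convergent and \<open>prev_num / prev_den\<close> the one before it. Recursion from the
  front of the list fits the recursion of \<^const>\<open>cfrac\<close>.
\<close>

fun cnum :: "nat list \<Rightarrow> nat" and cden :: "nat list \<Rightarrow> nat" where
  "cnum [] = 0"
| "cnum (a # as) = cden as"
| "cden [] = 1"
| "cden (a # as) = a * cden as + cnum as"

fun prev_num :: "nat list \<Rightarrow> nat" and prev_den :: "nat list \<Rightarrow> nat" where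
  "prev_num [] = 1"
| "prev_num (a # as) = prev_den as"
| "prev_den [] = 0"
| "prev_den (a # as) = a * prev_den as + prev_num as"

definition pos_list :: "nat list \<Rightarrow> bool" where
  "pos_list as \<longleftrightarrow> (\<forall>a\<in>set as. 1 \<le> a)"

lemma pos_list_simps [simp]:
  "pos_list []" "pos_list (a # as) \<longleftrightarrow> 1 \<le> a \<and> pos_list as"
  "pos_list (as @ bs) \<longleftrightarrow> pos_list as \<and> pos_list bs"
  by (auto simp: pos_list_def)

lemma pos_tuples_iff: "as \<in> pos_tuples n \<longleftrightarrow> length as = n \<and> pos_list as"
  by (simp add: pos_tuples_def pos_list_def)

lemma cden_pos: "pos_list as \<Longrightarrow> 0 < cden as"
  by (induction as) auto

lemma cnum_le_cden: "pos_list as \<Longrightarrow> cnum as \<le> cden as"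
proof (cases as)
  case (Cons a bs)
  assume "pos_list as"
  then have "1 \<le> a" using Cons by simp
  then have "1 * cden bs \<le> a * cden bs" by (rule mult_le_mono1)
  then show ?thesis unfolding Cons cnum.simps cden.simps by linarith
qed auto

text \<open>
  The claim on numerators, which makes the induction work, fails for the empty list, where the
  previous convergent is the formal fraction \<open>1 / 0\<close>.
\<close>
lemma prev_le_cden_aux:
  "pos_list as \<Longrightarrow> prev_den as \<le> cden as \<and> (as \<noteq> [] \<longrightarrow> prev_num as \<le> cnum as)"
proof (induction as)
  case (Cons a as)
  show ?case
  proof (cases "as = []")
    case False
    with Cons show ?thesis by (auto intro!: add_mono mult_left_mono)
  qed (use Cons in auto)
qed auto

lemma prev_den_le_cden: "pos_list as \<Longrightarrow> prev_den as \<le> cden as"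
  using prev_le_cden_aux by blast

text \<open>Multiplicativity of the underlying matrix product.\<close>
lemma continuant_append:
  "cnum (as @ bs) = cnum as * cden bs + prev_num as * cnum bs \<and>
   cden (as @ bs) = cden as * cden bs + prev_den as * cnum bs \<and>
   prev_num (as @ bs) = cnum as * prev_den bs + prev_num as * prev_num bs \<and>
   prev_den (as @ bs) = cden as * prev_den bs + prev_den as * prev_num bs"
  by (induction as) (auto simp: algebra_simps)

lemma cden_append_ge: "cden as * cden bs \<le> cden (as @ bs)"
  using continuant_append[of as bs] by simp

lemma cden_append_le:
  assumes "pos_list as" "pos_list bs"
  shows "cden (as @ bs) \<le> 2 * (cden as * cden bs)"
proof -
  have "prev_den as * cnum bs \<le> cden as * cden bs"
    using prev_den_le_cden[OF assms(1)] cnum_le_cden[OF assms(2)] by (rule mult_mono) auto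
  then show ?thesis using continuant_append[of as bs] by simp
qed

lemma continuant_det:
  "int (cnum as) * int (prev_den as) - int (prev_num as) * int (cden as) = (-1) ^ (length as + 1)"
  by (induction as) (auto simp: algebra_simps)

lemma coprime_continuants: "coprime (cnum as) (cden as)"
proof (induction as)
  case (Cons a as)
  have "gcd (cden as) (a * cden as + cnum as) = 1"
    using Cons.IH
    by (metis add.commute coprime_iff_gcd_eq_1 gcd.commute gcd_add_mult mult.commute)
  then show ?case by (simp add: coprime_iff_gcd_eq_1)
qed auto

lemma cfrac_eq: "pos_list as \<Longrightarrow> cfrac as = of_nat (cnum as) / of_nat (cden as)"
proof (induction as)
  case (Cons a as)
  then have q: "0 < cden as" using cden_pos by auto
  have "cfrac (a # as) = 1 / (of_nat a + of_nat (cnum as) / of_nat (cden as))"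
    using Cons by simp
  also have "\<dots> = of_nat (cden as) / (of_nat a * of_nat (cden as) + of_nat (cnum as))"
    using q by (simp add: add_divide_eq_iff)
  finally show ?case by simp
qed auto

lemma cf_denom_eq:
  assumes "pos_list as"
  shows "cf_denom as = int (cden as)"
proof -
  have "cfrac as = Fract (int (cnum as)) (int (cden as))"
    using cfrac_eq[OF assms] by (simp add: Fract_of_int_quotient)
  moreover have "coprime (int (cnum as)) (int (cden as))"
    using coprime_continuants by simp
  ultimately show ?thesis
    using cden_pos[OF assms] by (simp add: cf_denom_def quotient_of_Fract normalize_stable)
qed

section \<open>Inverse branches of the Gauss map\<close>

definition cf_map :: "nat list \<Rightarrow> real \<Rightarrow> real" where
  "cf_map as t = foldr (\<lambda>a u. 1 / (real a + u)) as t"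

lemma cf_map_simps [simp]:
  "cf_map [] t = t" "cf_map (a # as) t = 1 / (real a + cf_map as t)"
  "cf_map (as @ bs) t = cf_map as (cf_map bs t)"
  by (simp_all add: cf_map_def)

lemma cf_map_nonneg: "0 \<le> t \<Longrightarrow> 0 \<le> cf_map as t"
  by (induction as) auto

lemma cf_map_pos: "0 < t \<Longrightarrow> 0 < cf_map as t"
  by (induction as) (auto intro: add_nonneg_pos)

lemma cf_map_le_1: "pos_list as \<Longrightarrow> 0 \<le> t \<Longrightarrow> t \<le> 1 \<Longrightarrow> cf_map as t \<le> 1"
proof (induction as)
  case (Cons a as)
  then have "1 \<le> real a + cf_map as t" using cf_map_nonneg[of t as] by (simp add: add_increasing2)
  then show ?case by simp
qed auto

lemma cf_map_less_1: "pos_list as \<Longrightarrow> 0 < t \<Longrightarrow> t < 1 \<Longrightarrow> cf_map as t < 1"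
proof (induction as)
  case (Cons a as)
  have "1 \<le> real a" using Cons by simp
  then have "1 < real a + cf_map as t" using cf_map_pos[OF Cons.prems(2), of as] by linarith
  then show ?case by simp
qed auto

lemma cf_map_denominator_pos:
  assumes "pos_list as" "0 \<le> t"
  shows "0 < real (cden as) + t * real (prev_den as)"
  using cden_pos[OF assms(1)] assms(2) by (simp add: add_pos_nonneg)

lemma cf_map_moebius:
  assumes "pos_list as" "0 \<le> t"
  shows "cf_map as t = (real (cnum as) + t * real (prev_num as)) / (real (cden as) + t * real (prev_den as))"
  using assms
proof (induction as)
  case (Cons a as)
  have p: "0 < real (cden as) + t * real (prev_den as)"
    using Cons.prems by (intro cf_map_denominator_pos) auto
  have "cf_map (a # as) t
      = 1 / (real a + (real (cnum as) + t * real (prev_num as)) / (real (cden as) + t * real (prev_den as)))"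
    using Cons by simp
  also have "\<dots> = (real (cden as) + t * real (prev_den as)) /
      (real a * (real (cden as) + t * real (prev_den as)) + (real (cnum as) + t * real (prev_num as)))"
    using p by (simp add: add_divide_eq_iff)
  finally show ?case by (simp add: algebra_simps)
qed auto

text \<open>
  The determinant of the branch is \<open>\<plusminus>1\<close>, so the distortion is governed by the denominators alone. As
  the previous denominator is at most the current one, the contraction factor lies between
  \<open>1 / (4 q\<^sup>2)\<close> and \<open>1 / q\<^sup>2\<close> on the unit interval.
\<close>
lemma cf_map_dist:
  assumes "pos_list as" "0 \<le> t" "0 \<le> u"
  shows "\<bar>cf_map as t - cf_map as u\<bar>
       = \<bar>t - u\<bar> / ((real (cden as) + t * real (prev_den as)) * (real (cden as) + u * real (prev_den as)))"
proof -
  let ?p = "real (cnum as)" let ?q = "real (cden as)" let ?p' = "real (prev_num as)" let ?q' = "real (prev_den as)"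
  have pos: "0 < ?q + t * ?q'" "0 < ?q + u * ?q'"
    using cf_map_denominator_pos[OF assms(1)] assms by auto
  have det: "\<bar>?p * ?q' - ?p' * ?q\<bar> = 1"
  proof -
    have "?p * ?q' - ?p' * ?q = real_of_int (int (cnum as) * int (prev_den as) - int (prev_num as) * int (cden as))"
      by simp
    also have "\<dots> = (-1) ^ (length as + 1)" by (subst continuant_det) simp
    finally show ?thesis by (simp add: power_abs)
  qed
  have "cf_map as t - cf_map as u
      = ((?p + t * ?p') * (?q + u * ?q') - (?p + u * ?p') * (?q + t * ?q')) / ((?q + t * ?q') * (?q + u * ?q'))"
    using assms pos by (simp add: cf_map_moebius diff_frac_eq)
  also have "(?p + t * ?p') * (?q + u * ?q') - (?p + u * ?p') * (?q + t * ?q')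
      = (u - t) * (?p * ?q' - ?p' * ?q)"
    by (simp add: algebra_simps)
  finally show ?thesis
    using det pos by (simp add: abs_mult abs_minus_commute)
qed

lemma cf_map_dist_le:
  assumes "pos_list as" "0 \<le> t" "0 \<le> u"
  shows "\<bar>cf_map as t - cf_map as u\<bar> \<le> \<bar>t - u\<bar> / (real (cden as))\<^sup>2"
proof -
  have "real (cden as) * real (cden as) \<le> (real (cden as) + t * real (prev_den as)) * (real (cden as) + u * real (prev_den as))"
    using assms by (intro mult_mono) auto
  moreover have "0 < real (cden as)" using cden_pos[OF assms(1)] by simp
  ultimately show ?thesis
    unfolding cf_map_dist[OF assms] power2_eq_square by (intro divide_left_mono) (auto intro!: mult_pos_pos add_pos_nonneg simp: assms)
qed

lemma cf_map_dist_ge: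
  assumes "pos_list as" "0 \<le> t" "t \<le> 1" "0 \<le> u" "u \<le> 1"
  shows "\<bar>t - u\<bar> / (4 * (real (cden as))\<^sup>2) \<le> \<bar>cf_map as t - cf_map as u\<bar>"
proof -
  have le: "real (cden as) + v * real (prev_den as) \<le> 2 * real (cden as)" if "0 \<le> v" "v \<le> 1" for v
  proof -
    have "v * real (prev_den as) \<le> 1 * real (cden as)"
      using prev_den_le_cden[OF assms(1)] that by (intro mult_mono) auto
    then show ?thesis by simp
  qed
  have q: "0 < real (cden as)" using cden_pos[OF assms(1)] by simp
  have "(real (cden as) + t * real (prev_den as)) * (real (cden as) + u * real (prev_den as))
      \<le> (2 * real (cden as)) * (2 * real (cden as))"
    using assms le by (intro mult_mono) auto
  also have "\<dots> = 4 * (real (cden as))\<^sup>2" by (simp add: power2_eq_square)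
  finally show ?thesis
    unfolding cf_map_dist[OF assms(1,2,4)]
    using q assms by (intro divide_left_mono) (auto intro!: mult_pos_pos add_pos_nonneg)
qed

text \<open>Uniqueness of the expansion: the remainders lie in \<open>(0, 1)\<close>, so integer parts can be compared.\<close>
lemma cf_map_inj:
  assumes "length as = length bs" "pos_list as" "pos_list bs" "0 < t" "t < 1" "0 < u" "u < 1"
    and "cf_map as t = cf_map bs u"
  shows "as = bs \<and> t = u"
  using assms
proof (induction as bs rule: list_induct2)
  case (Cons a as b bs)
  have r: "0 < cf_map as t" "cf_map as t < 1" "0 < cf_map bs u" "cf_map bs u < 1"
    using Cons.prems by (auto intro: cf_map_pos cf_map_less_1)
  have "0 < real a + cf_map as t" "0 < real b + cf_map bs u" using r by (auto intro: add_nonneg_pos)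
  then have eq: "real a + cf_map as t = real b + cf_map bs u"
    using Cons.prems by (simp add: field_simps)
  then have "a = b" using r by linarith
  then show ?case using Cons eq by auto
qed auto


section \<open>Denominator sums and the pressure function\<close>

definition denom_sum :: "real \<Rightarrow> nat \<Rightarrow> real" where
  "denom_sum \<theta> n = (\<Sum>\<^sub>\<infinity>as\<in>pos_tuples n. real (cden as) powr (- 2 * \<theta>))"

lemma pressure_eq: "pressure \<theta> = lim (\<lambda>n. 1 / real n * ln (denom_sum \<theta> n))"
proof -
  have "(\<Sum>\<^sub>\<infinity>as\<in>pos_tuples n. of_int (cf_denom as) powr (- 2 * \<theta>)) = denom_sum \<theta> n" for n
    unfolding denom_sum_def by (rule infsum_cong) (simp add: pos_tuples_iff cf_denom_eq)
  then show ?thesis by (simp add: pressure_def)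
qed

lemma bij_betw_append_pos_tuples:
  "bij_betw (\<lambda>(as, bs). as @ bs) (pos_tuples n \<times> pos_tuples m) (pos_tuples (n + m))"
proof (rule bij_betw_byWitness[where f' = "\<lambda>cs. (take n cs, drop n cs)"])
  show "(\<lambda>cs. (take n cs, drop n cs)) ` pos_tuples (n + m) \<subseteq> pos_tuples n \<times> pos_tuples m"
    by (auto simp: pos_tuples_def dest: in_set_takeD in_set_dropD)
qed (auto simp: pos_tuples_def)

lemma has_sum_Times_nonneg:
  fixes f :: "'a \<Rightarrow> real" and g :: "'b \<Rightarrow> real"
  assumes "(f has_sum F) A" "(g has_sum G) B" "\<And>x. x \<in> A \<Longrightarrow> 0 \<le> f x" "\<And>y. y \<in> B \<Longrightarrow> 0 \<le> g y"
  shows "((\<lambda>(x, y). f x * g y) has_sum F * G) (A \<times> B)"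
proof (rule has_sum_SigmaI)
  show *: "((\<lambda>y. case (x, y) of (x, y) \<Rightarrow> f x * g y) has_sum f x * G) B" if "x \<in> A" for x
    using has_sum_cmult_right[OF assms(2), of "f x"] by simp
  show "((\<lambda>x. f x * G) has_sum F * G) A"
    by (rule has_sum_cmult_left[OF assms(1)])
  then have "(\<lambda>x. f x * G) summable_on A" by (rule has_sum_imp_summable)
  then show "(\<lambda>(x, y). f x * g y) summable_on A \<times> B"
    using * assms by (intro summable_on_SigmaI) auto
qed

lemma cden_powr_append_le:
  assumes "pos_list as" "pos_list bs" "0 \<le> \<theta>"
  shows "real (cden (as @ bs)) powr (- 2 * \<theta>)
       \<le> real (cden as) powr (- 2 * \<theta>) * real (cden bs) powr (- 2 * \<theta>)"
proof -
  have "0 < real (cden as) * real (cden bs)" using assms by (simp add: cden_pos)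
  moreover have "real (cden as) * real (cden bs) \<le> real (cden (as @ bs))"
    using cden_append_ge[of as bs] by (metis of_nat_le_iff of_nat_mult)
  ultimately have "real (cden (as @ bs)) powr (- 2 * \<theta>) \<le> (real (cden as) * real (cden bs)) powr (- 2 * \<theta>)"
    using assms by (intro powr_mono2') auto
  then show ?thesis by (simp add: powr_mult)
qed

lemma cden_powr_append_ge:
  assumes "pos_list as" "pos_list bs" "0 \<le> \<theta>"
  shows "2 powr (- 2 * \<theta>) * (real (cden as) powr (- 2 * \<theta>) * real (cden bs) powr (- 2 * \<theta>))
       \<le> real (cden (as @ bs)) powr (- 2 * \<theta>)"
proof -
  have "0 < real (cden (as @ bs))" using assms by (simp add: cden_pos)
  moreover have "real (cden (as @ bs)) \<le> 2 * (real (cden as) * real (cden bs))"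
    using cden_append_le[OF assms(1,2)] by (metis of_nat_le_iff of_nat_mult of_nat_numeral)
  ultimately have "(2 * (real (cden as) * real (cden bs))) powr (- 2 * \<theta>) \<le> real (cden (as @ bs)) powr (- 2 * \<theta>)"
    using assms by (intro powr_mono2') auto
  then show ?thesis by (simp add: powr_mult)
qed

lemma bij_betw_pos_tuples_1: "bij_betw (\<lambda>k. [Suc k]) UNIV (pos_tuples 1)"
proof -
  have "as \<in> range (\<lambda>k. [Suc k])" if as: "as \<in> pos_tuples 1" for as
  proof -
    obtain a where "as = [a]" using as by (auto simp: pos_tuples_def length_Suc_conv)
    then show ?thesis using as by (cases a) (auto simp: pos_tuples_def)
  qed
  then show ?thesis by (auto simp: bij_betw_def inj_on_def pos_tuples_def)
qed

lemma pos_tuples_0: "pos_tuples 0 = {[]}"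
  by (auto simp: pos_tuples_def)

text \<open>By submultiplicativity, convergence reduces to tuples of length 1, that is, to \<open>\<Sum> k\<^sup>-\<^sup>2\<^sup>\<theta>\<close>.\<close>
lemma denom_summable:
  assumes "\<theta> > 1 / 2"
  shows "(\<lambda>as. real (cden as) powr (- 2 * \<theta>)) summable_on pos_tuples n"
proof (induction n)
  case 0
  show ?case by (simp add: pos_tuples_0)
next
  case (Suc n)
  let ?h = "\<lambda>as. real (cden as) powr (- 2 * \<theta>)"
  have "summable (\<lambda>k. real k powr (- 2 * \<theta>))"
    using assms by (simp add: summable_real_powr_iff)
  then have "summable (\<lambda>k. real (Suc k) powr (- 2 * \<theta>))"
    by (subst summable_Suc_iff)
  then have "(\<lambda>k. ?h [Suc k]) summable_on UNIV"
    by (simp add: summable_on_UNIV_nonneg_real_iff)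
  then have 1: "?h summable_on pos_tuples 1"
    using summable_on_reindex_bij_betw[OF bij_betw_pos_tuples_1, of ?h] by simp
  have "(\<lambda>(as, bs). ?h as * ?h bs) summable_on pos_tuples 1 \<times> pos_tuples n"
    by (rule has_sum_imp_summable[OF has_sum_Times_nonneg[OF has_sum_infsum[OF 1] has_sum_infsum[OF Suc.IH]]]) auto
  then have "(\<lambda>x. ?h ((\<lambda>(as, bs). as @ bs) x)) summable_on pos_tuples 1 \<times> pos_tuples n"
  proof (rule summable_on_comparison_test)
    fix x assume "x \<in> pos_tuples 1 \<times> pos_tuples n"
    then obtain as bs where "x = (as, bs)" "pos_list as" "pos_list bs"
      by (auto simp: pos_tuples_iff)
    then show "?h ((\<lambda>(as, bs). as @ bs) x) \<le> (case x of (as, bs) \<Rightarrow> ?h as * ?h bs)"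
      using cden_powr_append_le[of as bs \<theta>] assms by simp
  qed auto
  then show ?case
    using summable_on_reindex_bij_betw[OF bij_betw_append_pos_tuples[of 1 n], of ?h] by simp
qed

lemma denom_sum_append:
  "denom_sum \<theta> (n + m) = (\<Sum>\<^sub>\<infinity>(as, bs)\<in>pos_tuples n \<times> pos_tuples m. real (cden (as @ bs)) powr (- 2 * \<theta>))"
  unfolding denom_sum_def
  by (subst infsum_reindex_bij_betw[OF bij_betw_append_pos_tuples, symmetric]) (simp add: case_prod_unfold)

lemma denom_sum_has_sum:
  assumes "\<theta> > 1 / 2"
  shows "((\<lambda>(as, bs). real (cden as) powr (- 2 * \<theta>) * real (cden bs) powr (- 2 * \<theta>))
           has_sum denom_sum \<theta> n * denom_sum \<theta> m) (pos_tuples n \<times> pos_tuples m)"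
  unfolding denom_sum_def
  by (intro has_sum_Times_nonneg has_sum_infsum denom_summable assms) auto

lemma denom_summable_append:
  assumes "\<theta> > 1 / 2"
  shows "(\<lambda>(as, bs). real (cden (as @ bs)) powr (- 2 * \<theta>)) summable_on pos_tuples n \<times> pos_tuples m"
  using denom_summable[OF assms, of "n + m"]
  by (subst (asm) summable_on_reindex_bij_betw[OF bij_betw_append_pos_tuples, symmetric]) (simp add: case_prod_unfold)

lemma denom_sum_submultiplicative:
  assumes "\<theta> > 1 / 2"
  shows "denom_sum \<theta> (n + m) \<le> denom_sum \<theta> n * denom_sum \<theta> m"
proof -
  have "((\<lambda>(as, bs). real (cden (as @ bs)) powr (- 2 * \<theta>)) has_sum denom_sum \<theta> (n + m)) (pos_tuples n \<times> pos_tuples m)"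
    unfolding denom_sum_append using denom_summable_append[OF assms] by (rule has_sum_infsum)
  then show ?thesis
    by (rule has_sum_mono[OF _ denom_sum_has_sum[OF assms]])
       (use assms cden_powr_append_le[where \<theta> = \<theta>] in \<open>auto simp: pos_tuples_iff\<close>)
qed

lemma denom_sum_supermultiplicative:
  assumes "\<theta> > 1 / 2"
  shows "2 powr (- 2 * \<theta>) * (denom_sum \<theta> n * denom_sum \<theta> m) \<le> denom_sum \<theta> (n + m)"
proof -
  have 1: "((\<lambda>(as, bs). real (cden (as @ bs)) powr (- 2 * \<theta>)) has_sum denom_sum \<theta> (n + m)) (pos_tuples n \<times> pos_tuples m)"
    unfolding denom_sum_append using denom_summable_append[OF assms] by (rule has_sum_infsum)
  show ?thesis
    by (rule has_sum_mono[OF has_sum_cmult_right[OF denom_sum_has_sum[OF assms]] 1])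
       (use assms cden_powr_append_ge[where \<theta> = \<theta>] in \<open>auto simp: pos_tuples_iff\<close>)
qed

lemma denom_sum_ge_finite:
  assumes "\<theta> > 1 / 2" "finite F" "F \<subseteq> pos_tuples n"
  shows "(\<Sum>as\<in>F. real (cden as) powr (- 2 * \<theta>)) \<le> denom_sum \<theta> n"
  unfolding denom_sum_def using assms by (intro finite_sum_le_infsum denom_summable) auto

lemma denom_sum_pos:
  assumes "\<theta> > 1 / 2"
  shows "0 < denom_sum \<theta> n"
proof -
  have r: "replicate n 1 \<in> pos_tuples n" by (auto simp: pos_tuples_def)
  then have "0 < real (cden (replicate n 1)) powr (- 2 * \<theta>)"
    by (auto simp: pos_tuples_iff dest: cden_pos)
  also have "\<dots> \<le> denom_sum \<theta> n"
    using denom_sum_ge_finite[OF assms, of "{replicate n 1}" n] r by simp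
  finally show ?thesis .
qed

lemma denom_sum_0: "denom_sum \<theta> 0 = 1"
  by (simp add: denom_sum_def pos_tuples_0)

lemma denom_sum_ge_power:
  assumes "\<theta> > 1 / 2"
  shows "(2 powr (- 2 * \<theta>) * denom_sum \<theta> 1) ^ n \<le> denom_sum \<theta> n"
proof (induction n)
  case (Suc n)
  let ?c = "2 powr (- 2 * \<theta>)"
  have "(?c * denom_sum \<theta> 1) * (?c * denom_sum \<theta> 1) ^ n \<le> (?c * denom_sum \<theta> 1) * denom_sum \<theta> n"
    using Suc denom_sum_pos[OF assms, of 1] by (intro mult_left_mono) auto
  also have "\<dots> \<le> denom_sum \<theta> (1 + n)"
    using denom_sum_supermultiplicative[OF assms, of 1 n] by (simp add: mult.assoc)
  finally show ?case by simp
qed (simp add: denom_sum_0)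

text \<open>
  Fekete's lemma. The limit is the infimum of the quotients: if \<open>u k / k\<close> is close to it, writing
  \<open>n = q k + r\<close> bounds \<open>u n\<close> by \<open>n (u k / k)\<close> up to a constant.
\<close>
lemma fekete_subadditive:
  fixes u :: "nat \<Rightarrow> real"
  assumes sub: "\<And>n m. u (n + m) \<le> u n + u m" and low: "\<And>n. c * real n \<le> u n"
  shows "convergent (\<lambda>n. u n / real n)"
proof -
  define L where "L = (INF n\<in>{1..}. u n / real n)"
  have bdd: "bdd_below ((\<lambda>n. u n / real n) ` {1..})"
    by (rule bdd_belowI2[of _ c]) (use low in \<open>auto simp: field_simps\<close>)
  have "(\<lambda>n. u n / real n) \<longlonglongrightarrow> L"
  proof (rule LIMSEQ_I)
    fix e :: real assume e: "0 < e"
    have "\<exists>k\<in>{1..}. u k / real k < L + e / 2"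
      unfolding L_def using bdd e by (subst cINF_less_iff[symmetric]) auto
    then obtain k where k: "1 \<le> k" "u k / real k < L + e / 2" by auto
    define M where "M = (\<Sum>r<k. \<bar>u r\<bar>) + \<bar>u k\<bar>"
    have mult: "u (q * k + r) \<le> real q * u k + u r" for q r
    proof (induction q)
      case (Suc q)
      have "u (Suc q * k + r) \<le> u k + u (q * k + r)"
        using sub[of k "q * k + r"] by (simp add: add.assoc)
      then show ?case using Suc by (simp add: algebra_simps)
    qed simp
    have bound: "u n \<le> real n * (u k / real k) + M" for n
    proof -
      let ?r = "n mod k"
      have r: "?r < k" using k by simp
      have "u n \<le> real (n div k) * u k + u ?r"
        using mult[of "n div k" ?r] by simp
      moreover have "u ?r \<le> (\<Sum>r<k. \<bar>u r\<bar>)"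
        using member_le_sum[of ?r "{..<k}" "\<lambda>r. \<bar>u r\<bar>"] r by simp
      moreover have "real (n div k) * u k = real n * (u k / real k) - real ?r / real k * u k"
      proof -
        have "real n = real (n div k) * real k + real ?r"
          by (metis div_mult_mod_eq of_nat_add of_nat_mult)
        then show ?thesis using k by (simp add: field_simps)
      qed
      moreover have "- (real ?r / real k * u k) \<le> \<bar>u k\<bar>"
      proof -
        have "\<bar>real ?r / real k * u k\<bar> \<le> 1 * \<bar>u k\<bar>"
          unfolding abs_mult using r k by (intro mult_right_mono) auto
        then show ?thesis by linarith
      qed
      ultimately show ?thesis unfolding M_def by linarith
    qed
    obtain n0 :: nat where n0: "2 * M / e < real n0" using reals_Archimedean2 by blast
    show "\<exists>no. \<forall>n\<ge>no. norm (u n / real n - L) < e"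
    proof (intro exI allI impI)
      fix n assume n: "max 1 n0 \<le> n"
      have "L \<le> u n / real n"
        unfolding L_def using bdd n by (intro cINF_lower) auto
      moreover have "u n / real n < L + e"
      proof -
        have "M / real n < e / 2"
        proof -
          have "2 * M / e < real n" using n0 n by linarith
          then show ?thesis using e n by (simp add: field_simps)
        qed
        moreover have "u n / real n \<le> u k / real k + M / real n"
          using bound[of n] n by (simp add: field_simps)
        ultimately show ?thesis using k by linarith
      qed
      ultimately show "norm (u n / real n - L) < e" by simp
    qed
  qed
  then show ?thesis by (auto simp: convergent_def)
qed

lemma pressure_limit:
  assumes "\<theta> > 1 / 2"
  shows "(\<lambda>n. ln (denom_sum \<theta> n) / real n) \<longlonglongrightarrow> pressure \<theta>"
proof -
  note pos = denom_sum_pos[OF assms]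
  have "convergent (\<lambda>n. ln (denom_sum \<theta> n) / real n)"
  proof (rule fekete_subadditive)
    fix n m
    have "ln (denom_sum \<theta> (n + m)) \<le> ln (denom_sum \<theta> n * denom_sum \<theta> m)"
      using denom_sum_submultiplicative[OF assms] pos by simp
    then show "ln (denom_sum \<theta> (n + m)) \<le> ln (denom_sum \<theta> n) + ln (denom_sum \<theta> m)"
      using pos[of n] pos[of m] by (simp add: ln_mult)
  next
    fix n
    have "ln ((2 powr (- 2 * \<theta>) * denom_sum \<theta> 1) ^ n) \<le> ln (denom_sum \<theta> n)"
      using denom_sum_ge_power[OF assms] pos by simp
    then show "ln (2 powr (- 2 * \<theta>) * denom_sum \<theta> 1) * real n \<le> ln (denom_sum \<theta> n)"
      using pos[of 1] by (simp add: ln_realpow mult.commute)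
  qed
  then show ?thesis
    unfolding pressure_eq by (simp add: convergent_LIMSEQ_iff)
qed

lemma pressure_ge:
  assumes "\<theta> > 1 / 2"
  shows "ln (denom_sum \<theta> 1) - 2 * \<theta> * ln 2 \<le> pressure \<theta>"
proof (rule LIMSEQ_le_const[OF pressure_limit[OF assms]], intro exI allI impI)
  fix n :: nat assume n: "1 \<le> n"
  note pos = denom_sum_pos[OF assms]
  have "ln ((2 powr (- 2 * \<theta>) * denom_sum \<theta> 1) ^ n) \<le> ln (denom_sum \<theta> n)"
    using denom_sum_ge_power[OF assms] pos by simp
  then have "real n * (ln (denom_sum \<theta> 1) - 2 * \<theta> * ln 2) \<le> ln (denom_sum \<theta> n)"
    using pos[of 1] by (simp add: ln_realpow ln_mult ln_powr algebra_simps)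
  then show "ln (denom_sum \<theta> 1) - 2 * \<theta> * ln 2 \<le> ln (denom_sum \<theta> n) / real n"
    using n by (simp add: field_simps)
qed

lemma pressure_antimono:
  assumes "1 / 2 < \<theta>" "\<theta> \<le> \<theta>'"
  shows "pressure \<theta>' \<le> pressure \<theta>"
proof (rule LIMSEQ_le[OF pressure_limit pressure_limit])
  have "denom_sum \<theta>' n \<le> denom_sum \<theta> n" for n
    unfolding denom_sum_def
  proof (intro infsum_mono denom_summable)
    fix as assume "as \<in> pos_tuples n"
    then have "1 \<le> cden as" using cden_pos[of as] by (simp add: pos_tuples_iff)
    then show "real (cden as) powr (- 2 * \<theta>') \<le> real (cden as) powr (- 2 * \<theta>)"
      using assms by (intro powr_mono) auto
  qed (use assms in auto)
  then show "\<exists>N. \<forall>n\<ge>N. ln (denom_sum \<theta>' n) / real n \<le> ln (denom_sum \<theta> n) / real n"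
    using assms by (intro exI[of _ 0]) (auto intro!: divide_right_mono simp: denom_sum_pos)
qed (use assms in auto)

text \<open>
  Hoelder's inequality in the weighted form \<open>\<Sum> f\<^sup>p g\<^sup>q \<le> (\<Sum> f)\<^sup>p (\<Sum> g)\<^sup>q\<close>: after normalising both sums to
  1 it is Young's inequality summed over all indices.
\<close>
lemma holder_infsum:
  fixes f g :: "'a \<Rightarrow> real"
  assumes "f summable_on A" "g summable_on A" "\<And>x. x \<in> A \<Longrightarrow> 0 < f x" "\<And>x. x \<in> A \<Longrightarrow> 0 < g x"
    and "0 \<le> p" "0 \<le> q" "p + q = 1" "0 < infsum f A" "0 < infsum g A"
  shows "infsum (\<lambda>x. f x powr p * g x powr q) A \<le> infsum f A powr p * infsum g A powr q"
proof -
  let ?F = "infsum f A" and ?G = "infsum g A"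
  let ?C = "?F powr p * ?G powr q"
  have hs: "((\<lambda>x. ?C * (p * (f x / ?F) + q * (g x / ?G))) has_sum ?C * (p * (?F / ?F) + q * (?G / ?G))) A"
    unfolding divide_inverse
    by (intro has_sum_cmult_right has_sum_cmult_left has_sum_add has_sum_infsum assms)
  have le: "f x powr p * g x powr q \<le> ?C * (p * (f x / ?F) + q * (g x / ?G))" if "x \<in> A" for x
  proof -
    have "(f x / ?F) powr p * (g x / ?G) powr q \<le> p * (f x / ?F) + q * (g x / ?G)"
      using assms that by (intro Youngs_inequality_0) auto
    then have "?C * ((f x / ?F) powr p * (g x / ?G) powr q) \<le> ?C * (p * (f x / ?F) + q * (g x / ?G))"
      by (intro mult_left_mono) auto
    moreover have "?C * ((f x / ?F) powr p * (g x / ?G) powr q) = f x powr p * g x powr q"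
      using assms that by (simp add: powr_divide less_imp_le)
    ultimately show ?thesis by simp
  qed
  have "(\<lambda>x. f x powr p * g x powr q) summable_on A"
    using has_sum_imp_summable[OF hs] by (rule summable_on_comparison_test) (use le in auto)
  then have "infsum (\<lambda>x. f x powr p * g x powr q) A \<le> ?C * (p * (?F / ?F) + q * (?G / ?G))"
    using le by (intro has_sum_mono[OF has_sum_infsum hs]) auto
  then show ?thesis using assms by simp
qed

lemma pressure_convex: "convex_on {1 / 2<..} pressure"
proof (rule convex_onI)
  fix t x y :: real
  assume t: "0 < t" "t < 1" and x: "x \<in> {1 / 2<..}" and y: "y \<in> {1 / 2<..}"
  let ?z = "(1 - t) * x + t * y"
  have z: "1 / 2 < ?z"
    using convexD_alt[OF convex_real_interval(3) x y, of t] t by simp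
  have le: "ln (denom_sum ?z n) / real n
      \<le> (1 - t) * (ln (denom_sum x n) / real n) + t * (ln (denom_sum y n) / real n)" for n
  proof -
    let ?f = "\<lambda>\<theta> as. real (cden as) powr (- 2 * \<theta>)"
    have pos: "0 < denom_sum x n" "0 < denom_sum y n" "0 < denom_sum ?z n"
      using x y z by (auto intro: denom_sum_pos)
    have "denom_sum ?z n = infsum (\<lambda>as. ?f x as powr (1 - t) * ?f y as powr t) (pos_tuples n)"
      unfolding denom_sum_def
      by (rule infsum_cong) (simp add: powr_powr powr_add[symmetric] algebra_simps)
    also have "\<dots> \<le> denom_sum x n powr (1 - t) * denom_sum y n powr t"
      unfolding denom_sum_def using x y t pos
      by (intro holder_infsum denom_summable) (auto simp: pos_tuples_iff denom_sum_def dest: cden_pos)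
    finally have "ln (denom_sum ?z n) \<le> ln (denom_sum x n powr (1 - t) * denom_sum y n powr t)"
      using pos by simp
    also have "\<dots> = (1 - t) * ln (denom_sum x n) + t * ln (denom_sum y n)"
      using pos by (simp add: ln_mult ln_powr)
    finally show ?thesis
      by (metis add_divide_distrib divide_right_mono of_nat_0_le_iff times_divide_eq_right)
  qed
  have "pressure ?z \<le> (1 - t) * pressure x + t * pressure y"
  proof (rule LIMSEQ_le[OF pressure_limit[OF z]])
    show "(\<lambda>n. (1 - t) * (ln (denom_sum x n) / real n) + t * (ln (denom_sum y n) / real n))
        \<longlonglongrightarrow> (1 - t) * pressure x + t * pressure y"
      using x y by (intro tendsto_intros pressure_limit) auto
  qed (use le in auto)
  then show "pressure ((1 - t) *\<^sub>R x + t *\<^sub>R y) \<le> (1 - t) * pressure x + t * pressure y" by simp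
qed simp

lemma pressure_continuous: "continuous_on {1 / 2<..} pressure"
  by (rule convex_on_continuous[OF _ pressure_convex]) simp

lemma bounded_lists_Suc:
  "bij_betw (\<lambda>(as, a). as @ [a]) ({as. length as = n \<and> set as \<subseteq> A} \<times> A) {as. length as = Suc n \<and> set as \<subseteq> A}"
proof (rule bij_betw_byWitness[where f' = "\<lambda>cs. (butlast cs, last cs)"])
  show "(\<lambda>cs. (butlast cs, last cs)) ` {as. length as = Suc n \<and> set as \<subseteq> A}
      \<subseteq> {as. length as = n \<and> set as \<subseteq> A} \<times> A"
    by (auto dest: in_set_butlastD intro: last_in_set simp: subset_iff) (metis last_in_set length_greater_0_conv zero_less_Suc)
qed (auto simp: append_butlast_last_id simp flip: length_greater_0_conv)

text \<open>
  The summand is the length of the cylinder with partial quotients \<open>as\<close>. The lengths of the children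
  \<open>as @ [a]\<close> of a cylinder telescope, their sum over all \<open>a\<close> being the length of the parent.
\<close>
lemma sum_cylinder_lengths_le_1:
  "(\<Sum>as | length as = n \<and> set as \<subseteq> {1..M}. 1 / (real (cden as) * real (cden as + prev_den as))) \<le> 1"
proof (induction n)
  case 0
  have "{as::nat list. length as = 0 \<and> set as \<subseteq> {1..M}} = {[]}" by auto
  then show ?case by simp
next
  case (Suc n)
  let ?L = "{as. length as = n \<and> set as \<subseteq> {1..M}}"
  let ?g = "\<lambda>as. 1 / (real (cden as) * real (cden as + prev_den as))"
  have inner: "(\<Sum>a\<in>{1..M}. ?g (as @ [a])) \<le> ?g as" if "as \<in> ?L" for as
  proof -
    have "pos_list as" using that by (auto simp: pos_list_def)
    then have pos: "0 < real (cden as)" by (simp add: cden_pos)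
    define q q' where "q = real (cden as)" and "q' = real (prev_den as)"
    have q: "0 < q" "0 \<le> q'" using pos by (auto simp: q_def q'_def)
    have g: "?g (as @ [a]) = 1 / ((real a * q + q') * (real a * q + q' + q))" for a
      using continuant_append[of as "[a]"] by (simp add: q_def q'_def algebra_simps)
    have t: "1 / ((real a * q + q') * (real a * q + q' + q))
        = 1 / q * (1 / (real a * q + q') - 1 / (real (Suc a) * q + q'))" if "1 \<le> a" for a
    proof -
      have "0 < real a * q + q'" using q that by (intro add_pos_nonneg) auto
      moreover have "0 < real a * q + q' + q" using calculation q by simp
      ultimately have "1 / (real a * q + q') - 1 / (real a * q + q' + q) = q / ((real a * q + q') * (real a * q + q' + q))"
        by (simp add: diff_frac_eq)
      then show ?thesis using q by (simp add: algebra_simps)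
    qed
    have "(\<Sum>a\<in>{1..M}. ?g (as @ [a])) = 1 / q * (\<Sum>a\<in>{1..M}. 1 / (real a * q + q') - 1 / (real (Suc a) * q + q'))"
      unfolding sum_distrib_left by (rule sum.cong) (use g t in auto)
    also have "(\<Sum>a\<in>{1..M}. 1 / (real a * q + q') - 1 / (real (Suc a) * q + q'))
        = 1 / (q + q') - 1 / (real (Suc M) * q + q')"
      by (induction M) (auto simp: algebra_simps)
    also have "1 / q * \<dots> \<le> 1 / q * (1 / (q + q'))"
      using q by (intro mult_left_mono) auto
    also have "\<dots> = ?g as" by (simp add: q_def q'_def)
    finally show ?thesis .
  qed
  have "(\<Sum>as | length as = Suc n \<and> set as \<subseteq> {1..M}. ?g as) = (\<Sum>(as, a)\<in>?L \<times> {1..M}. ?g (as @ [a]))"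
    using sum.reindex_bij_betw[OF bounded_lists_Suc[of n "{1..M}"], of ?g] by (simp add: case_prod_unfold)
  also have "\<dots> = (\<Sum>as\<in>?L. \<Sum>a\<in>{1..M}. ?g (as @ [a]))"
    by (subst sum.cartesian_product) simp
  also have "\<dots> \<le> (\<Sum>as\<in>?L. ?g as)" by (rule sum_mono[OF inner])
  also have "\<dots> \<le> 1" by (rule Suc.IH)
  finally show ?case .
qed

lemma denom_sum_1_le_2: "denom_sum 1 n \<le> 2"
  unfolding denom_sum_def
proof (rule infsum_le_finite_sums)
  fix F assume F: "finite F" "F \<subseteq> pos_tuples n"
  define M where "M = Max (insert 0 (\<Union>as\<in>F. set as))"
  let ?L = "{as. length as = n \<and> set as \<subseteq> {1..M}}"
  have "F \<subseteq> ?L"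
  proof -
    have "a \<le> M" if "as \<in> F" "a \<in> set as" for a as
      unfolding M_def using F that by (intro Max_ge) auto
    then show ?thesis using F by (auto simp: pos_tuples_def)
  qed
  have finL: "finite ?L" using finite_lists_length_eq[of "{1..M}" n] by (simp add: conj_commute)
  have "(\<Sum>as\<in>F. real (cden as) powr (- 2 * 1)) \<le> (\<Sum>as\<in>?L. real (cden as) powr (- 2 * 1))"
    using \<open>F \<subseteq> ?L\<close> finL by (intro sum_mono2) auto
  also have "\<dots> \<le> (\<Sum>as\<in>?L. 2 * (1 / (real (cden as) * real (cden as + prev_den as))))"
  proof (rule sum_mono)
    fix as assume "as \<in> ?L"
    then have p: "pos_list as" by (auto simp: pos_list_def)
    have q: "0 < real (cden as)" using cden_pos[OF p] by simp
    have "real (cden as) * real (cden as + prev_den as) \<le> real (cden as) * (2 * real (cden as))"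
      using prev_den_le_cden[OF p] by (intro mult_left_mono) auto
    then have "1 / (real (cden as) * (2 * real (cden as))) \<le> 1 / (real (cden as) * real (cden as + prev_den as))"
      using q by (intro divide_left_mono) (auto intro!: mult_pos_pos)
    moreover have "real (cden as) powr (- 2 * 1) = 1 / (real (cden as) * real (cden as))"
    proof -
      have "real (cden as) powr (- 2 * 1) = 1 / real (cden as) powr 2"
        by (simp add: powr_minus_divide)
      also have "real (cden as) powr 2 = real (cden as) * real (cden as)"
        using q by (simp add: powr_numeral power2_eq_square)
      finally show ?thesis .
    qed
    moreover have "1 / (real (cden as) * real (cden as)) = 2 * (1 / (real (cden as) * (2 * real (cden as))))"
      by simp
    ultimately show "real (cden as) powr (- 2 * 1) \<le> 2 * (1 / (real (cden as) * real (cden as + prev_den as)))"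
      by linarith
  qed
  also have "\<dots> \<le> 2 * 1"
    unfolding sum_distrib_left[symmetric] by (intro mult_left_mono sum_cylinder_lengths_le_1) auto
  finally show "(\<Sum>as\<in>F. real (cden as) powr (- 2 * 1)) \<le> 2" by simp
qed (use denom_summable[of 1] in auto)

lemma pressure_1_nonpos: "pressure 1 \<le> 0"
proof (rule LIMSEQ_le[OF pressure_limit])
  show "(\<lambda>n. ln 2 / real n) \<longlonglongrightarrow> 0" by (rule lim_const_over_n)
  show "\<exists>N. \<forall>n\<ge>N. ln (denom_sum 1 n) / real n \<le> ln 2 / real n"
    using denom_sum_1_le_2 by (intro exI[of _ 0]) (auto intro!: divide_right_mono simp: denom_sum_pos)
qed simp

text \<open>
  At \<open>\<theta> = 1/2\<close> the sum over tuples of length 1 is the harmonic series, so a finite part of it is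
  large there and, by continuity, slightly to the right of \<open>1/2\<close>.
\<close>
lemma exists_large_denom_sum:
  "\<exists>\<theta>. 1 / 2 < \<theta> \<and> \<theta> < 1 \<and> C < denom_sum \<theta> 1"
proof -
  have "\<not> summable (\<lambda>k. 1 / real k)"
    using not_summable_harmonic[where 'a = real] by (simp only: divide_inverse mult_1_left) simp
  then have not_summable: "\<not> summable (\<lambda>k. 1 / real (Suc k))"
    using summable_Suc_iff[of "\<lambda>k. 1 / real k"] by blast
  have "\<exists>K. C < (\<Sum>k<K. 1 / real (Suc k))"
  proof (rule ccontr)
    assume "\<nexists>K. C < (\<Sum>k<K. 1 / real (Suc k))"
    then have "summable (\<lambda>k. 1 / real (Suc k))"
      by (intro summableI_nonneg_bounded[where x = C]) (auto simp: not_less)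
    with not_summable show False by blast
  qed
  then obtain K where K: "C < (\<Sum>k<K. 1 / real (Suc k))" by blast
  let ?h = "\<lambda>\<theta>::real. (\<Sum>k<K. real (Suc k) powr (- 2 * \<theta>))"
  have "(?h \<longlongrightarrow> ?h (1 / 2)) (at_right (1 / 2))"
    by (intro tendsto_intros) auto
  moreover have "?h (1 / 2) = (\<Sum>k<K. 1 / real (Suc k))"
    by (simp add: powr_minus_divide)
  ultimately have "eventually (\<lambda>\<theta>. C < ?h \<theta>) (at_right (1 / 2))"
    using K by (simp add: order_tendstoD(1))
  moreover have "eventually (\<lambda>\<theta>::real. \<theta> \<in> {1 / 2<..<1}) (at_right (1 / 2))"
    by (rule eventually_at_right_real) simp
  ultimately have "eventually (\<lambda>\<theta>. C < ?h \<theta> \<and> \<theta> \<in> {1 / 2<..<1}) (at_right (1 / 2))"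
    by (rule eventually_conj)
  then obtain \<theta> where \<theta>: "C < ?h \<theta>" "1 / 2 < \<theta>" "\<theta> < 1"
    using eventually_happens'[of "at_right (1/2::real)"] by auto
  have "?h \<theta> = (\<Sum>as\<in>(\<lambda>k. [Suc k]) ` {..<K}. real (cden as) powr (- 2 * \<theta>))"
    by (subst sum.reindex) (auto simp: inj_on_def)
  also have "\<dots> \<le> denom_sum \<theta> 1"
    using \<theta> by (intro denom_sum_ge_finite) (auto simp: pos_tuples_def)
  finally show ?thesis using \<theta> by auto
qed

lemma pressure_root_exists:
  fixes B :: real
  assumes "B > 1"
  shows "\<exists>\<theta>. 1 / 2 < \<theta> \<and> \<theta> \<le> 1 \<and> pressure \<theta> = \<theta> * ln B"
proof -
  obtain \<theta> where \<theta>: "1 / 2 < \<theta>" "\<theta> < 1" "exp (ln B + 2 * ln 2) < denom_sum \<theta> 1"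
    using exists_large_denom_sum by blast
  let ?h = "\<lambda>\<theta>. pressure \<theta> - \<theta> * ln B"
  have "ln (exp (ln B + 2 * ln 2)) < ln (denom_sum \<theta> 1)"
    using \<theta> denom_sum_pos[of \<theta> 1] by (subst ln_less_cancel_iff) auto
  then have "ln B + 2 * ln 2 < ln (denom_sum \<theta> 1)" by simp
  moreover have "2 * \<theta> * ln 2 \<le> 2 * ln (2::real)" "\<theta> * ln B \<le> ln B"
    using \<theta> assms by (auto simp: mult_left_le_one_le)
  ultimately have "0 \<le> ?h \<theta>" using pressure_ge[OF \<theta>(1)] by linarith
  moreover have "?h 1 \<le> 0" using pressure_1_nonpos assms by (simp add: ln_gt_zero less_imp_le order_trans[OF pressure_1_nonpos])
  moreover have "continuous_on {\<theta>..1} ?h"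
    using \<theta> by (intro continuous_intros continuous_on_subset[OF pressure_continuous]) auto
  ultimately have "\<exists>x\<ge>\<theta>. x \<le> 1 \<and> ?h x = 0"
    using \<theta> by (intro IVT2') auto
  then obtain x where "\<theta> \<le> x" "x \<le> 1" "pressure x - x * ln B = 0" by blast
  then show ?thesis using \<theta> by (intro exI[of _ x]) auto
qed

lemma pressure_minus_linear_strict_antimono:
  fixes B :: real
  assumes "B > 1" "1 / 2 < \<theta>" "\<theta> < \<theta>'"
  shows "pressure \<theta>' - \<theta>' * ln B < pressure \<theta> - \<theta> * ln B"
proof -
  have "\<theta> * ln B < \<theta>' * ln B" using assms by (intro mult_strict_right_mono) (auto simp: ln_gt_zero)
  then show ?thesis using pressure_antimono[of \<theta> \<theta>'] assms by linarith
qed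


section \<open>Covers and the upper bound\<close>

lemma cf_map_partial_quotients:
  assumes "x \<in> irrational_unit"
  shows "x = cf_map (map (\<lambda>k. partial_quotient (Suc k) x) [0..<n]) ((gauss_map ^^ n) x)"
proof -
  have "[1..<Suc n] = map Suc [0..<n]" by (simp add: map_Suc_upt)
  then show ?thesis
    using partial_quotient_expansion[OF assms, of n]
    by (simp add: cf_map_def foldr_map o_def del: upt_Suc)
qed

lemma pos_list_partial_quotients:
  "x \<in> irrational_unit \<Longrightarrow> pos_list (map (\<lambda>k. partial_quotient (Suc k) x) [0..<n])"
  using partial_quotient_ge_1 by (auto simp: pos_list_def)

text \<open>
  The \<open>n\<close>-th term bounds the total \<open>\<theta>\<close>-gauge of the cover of \<open>{x. a\<^sub>n\<^sub>+\<^sub>1(x) \<ge> B\<^sup>n\<^sup>+\<^sup>1}\<close> by the images of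
  \<open>[0, B\<^sup>-\<^sup>(\<^sup>n\<^sup>+\<^sup>1\<^sup>)]\<close> under the branches of order \<open>n\<close>.
\<close>
lemma large_quotient_cover_summable:
  fixes B :: real
  assumes "B > 1" "\<theta> > 1 / 2" "pressure \<theta> < \<theta> * ln B"
  shows "summable (\<lambda>n. (1 / B ^ (n + 1)) powr \<theta> * denom_sum \<theta> n)"
proof -
  define c where "c = (pressure \<theta> + \<theta> * ln B) / 2"
  have c: "pressure \<theta> < c" "c < \<theta> * ln B" using assms by (auto simp: c_def)
  have ev: "eventually (\<lambda>n. ln (denom_sum \<theta> n) / real n < c) sequentially"
    using pressure_limit[OF assms(2)] c by (simp add: order_tendstoD(2))
  have "eventually (\<lambda>n. norm ((1 / B ^ (n + 1)) powr \<theta> * denom_sum \<theta> n) \<le> exp (c - \<theta> * ln B) ^ n) sequentially"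
    using ev eventually_gt_at_top[of 0]
  proof eventually_elim
    case (elim n)
    have pos: "0 < denom_sum \<theta> n" using denom_sum_pos[OF assms(2)] .
    have "ln (denom_sum \<theta> n) \<le> c * real n" using elim by (simp add: field_simps)
    then have 1: "denom_sum \<theta> n \<le> exp (c * real n)"
      using pos by (metis exp_le_cancel_iff exp_ln)
    have "(1 / B ^ (n + 1)) powr \<theta> = exp (\<theta> * ln (1 / B ^ (n + 1)))"
      using assms by (simp add: powr_def)
    also have "ln (1 / B ^ (n + 1)) = - (real (n + 1) * ln B)"
      using assms by (simp add: ln_div ln_realpow ln_mult algebra_simps)
    also have "exp (\<theta> * - (real (n + 1) * ln B)) \<le> exp (- \<theta> * ln B * real n)"
      using assms by (simp add: algebra_simps)
    finally have "(1 / B ^ (n + 1)) powr \<theta> * denom_sum \<theta> n \<le> exp (- \<theta> * ln B * real n) * exp (c * real n)"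
      using 1 pos by (intro mult_mono) auto
    also have "\<dots> = exp (c - \<theta> * ln B) ^ n"
      by (simp add: exp_add[symmetric] exp_of_nat_mult[symmetric] algebra_simps)
    finally show ?case using pos by (simp add: abs_mult)
  qed
  then show ?thesis
    by (rule summable_comparison_test_ev) (use c in \<open>auto intro!: summable_geometric\<close>)
qed

text \<open>
  Every point of the limsup set lies in pieces of arbitrarily high generation, so all pieces of
  generation at least \<open>N\<close> together cover it. Their total gauge is a tail of a convergent series.
\<close>
lemma hausdorff_content_large_quotient_set_le:
  fixes B :: real
  assumes "B > 1" "\<theta> > 1 / 2" "pressure \<theta> < \<theta> * ln B" "0 < \<delta>" "0 < e"
  shows "hausdorff_content \<theta> \<delta> (large_quotient_set B) \<le> ennreal e"
proof -
  let ?g = "\<lambda>n. (1 / B ^ (n + 1)) powr \<theta> * denom_sum \<theta> n"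
  obtain N1 where N1: "norm (sum ?g {m..<n}) < e" if "N1 \<le> m" for m n
    using large_quotient_cover_summable[OF assms(1-3)] assms(5) unfolding summable_Cauchy by blast
  obtain N2 where N2: "(1 / B) ^ N2 < \<delta>"
    using real_arch_pow_inv[of \<delta> "1 / B"] assms by auto
  define N where "N = max N1 N2"
  define V where "V as = cf_map as ` {0..1 / B ^ (length as + 1)}" for as
  define ok where "ok as \<longleftrightarrow> pos_list as \<and> N \<le> length as" for as
  \<comment> \<open>The cover must be a sequence, so its members are numbered by a bijection of \<open>\<nat>\<close> with the lists.\<close>
  define U where "U i = (if ok (list_decode i) then V (list_decode i) else {})" for i
  have small: "0 < 1 / B ^ (n + 1)" "1 / B ^ (n + 1) \<le> 1" for n
    using assms(1) one_le_power[of B "n + 1"] by (auto simp: field_simps)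
  have V_bounded: "bounded (V as)" if "pos_list as" for as
  proof (rule bounded_subset[of "{0..1}"])
    show "V as \<subseteq> {0..1}"
    proof
      fix y assume "y \<in> V as"
      then obtain t where "y = cf_map as t" "0 \<le> t" "t \<le> 1 / B ^ (length as + 1)"
        by (auto simp: V_def)
      then show "y \<in> {0..1}"
        using small(2)[of "length as"] that cf_map_nonneg[of t as] cf_map_le_1[of as t] by simp
    qed
  qed simp
  have V_diam: "diameter (V as) \<le> 1 / B ^ (length as + 1) / (real (cden as))\<^sup>2" if as: "pos_list as" for as
  proof (rule diameter_le)
    fix x y assume "x \<in> V as" "y \<in> V as"
    then obtain t u where tu: "x = cf_map as t" "y = cf_map as u"
      "0 \<le> t" "t \<le> 1 / B ^ (length as + 1)" "0 \<le> u" "u \<le> 1 / B ^ (length as + 1)"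
      by (auto simp: V_def)
    have "\<bar>x - y\<bar> \<le> \<bar>t - u\<bar> / (real (cden as))\<^sup>2"
      using tu as by (simp add: cf_map_dist_le)
    also have "\<dots> \<le> 1 / B ^ (length as + 1) / (real (cden as))\<^sup>2"
      using tu by (intro divide_right_mono) auto
    finally show "norm (x - y) \<le> 1 / B ^ (length as + 1) / (real (cden as))\<^sup>2" by simp
  qed (use small[of "length as"] in auto)
  have cover: "large_quotient_set B \<subseteq> (\<Union>i. U i)"
  proof
    fix x assume "x \<in> large_quotient_set B"
    then have x: "x \<in> irrational_unit" and inf: "infinite {n. 1 \<le> n \<and> B ^ n \<le> real (partial_quotient n x)}"
      by (auto simp: large_quotient_set_def)
    obtain n where n: "N < n" "B ^ n \<le> real (partial_quotient n x)"
      using inf unfolding infinite_nat_iff_unbounded by blast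
    define m where "m = n - 1"
    have m: "n = Suc m" "N \<le> m" using n by (auto simp: m_def)
    let ?t = "(gauss_map ^^ m) x"
    have t: "0 < ?t" "?t < 1"
      using irrational_unit_pos[OF gauss_map_funpow_irrational_unit[OF x]] by auto
    have "B ^ n \<le> real (nat \<lfloor>1 / ?t\<rfloor>)" using n m by (simp add: partial_quotient_def)
    also have "\<dots> \<le> 1 / ?t" using t by simp
    finally have "?t \<le> 1 / B ^ (m + 1)" using t assms(1) m by (simp add: field_simps)
    let ?as = "map (\<lambda>k. partial_quotient (Suc k) x) [0..<m]"
    have "x = cf_map ?as ?t" by (rule cf_map_partial_quotients[OF x])
    then have "x \<in> V ?as"
      unfolding V_def using t \<open>?t \<le> 1 / B ^ (m + 1)\<close> by (intro image_eqI[of _ _ ?t]) auto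
    moreover have "ok ?as" using m pos_list_partial_quotients[OF x] by (simp add: ok_def)
    ultimately have "x \<in> U (list_encode ?as)" by (simp add: U_def)
    then show "x \<in> (\<Union>i. U i)" by blast
  qed
  have U_small: "bounded (U i) \<and> diameter (U i) \<le> \<delta>" for i
  proof (cases "ok (list_decode i)")
    case True
    let ?as = "list_decode i"
    have as: "pos_list ?as" "N \<le> length ?as" using True by (auto simp: ok_def)
    have "1 / B ^ (length ?as + 1) / (real (cden ?as))\<^sup>2 \<le> 1 / B ^ (length ?as + 1) / 1"
      using cden_pos[OF as(1)] small[of "length ?as"] by (intro divide_left_mono) auto
    also have "\<dots> \<le> (1 / B) ^ N2"
    proof -
      have "B ^ N2 \<le> B ^ (length ?as + 1)"
        using assms(1) as(2) by (intro power_increasing) (auto simp: N_def)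
      then show ?thesis using assms(1) by (simp add: power_one_over field_simps)
    qed
    finally show ?thesis
      using V_diam[OF as(1)] V_bounded[OF as(1)] N2 True unfolding U_def by simp
  qed (use assms in \<open>auto simp: U_def\<close>)
  define h where "h as = (if ok as then (1 / B ^ (length as + 1)) powr \<theta> * real (cden as) powr (- 2 * \<theta>) else 0)" for as
  have h_nonneg: "0 \<le> h as" for as by (simp add: h_def)
  have U_h: "diam_pow \<theta> (U i) \<le> h (list_decode i)" for i
  proof (cases "ok (list_decode i)")
    case True
    let ?as = "list_decode i"
    have as: "pos_list ?as" using True by (auto simp: ok_def)
    have q: "0 < real (cden ?as)" using cden_pos[OF as] by simp
    have "diam_pow \<theta> (U i) \<le> diameter (V ?as) powr \<theta>"
      using True assms(2) by (simp add: diam_pow_def U_def)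
    also have "\<dots> \<le> (1 / B ^ (length ?as + 1) / (real (cden ?as))\<^sup>2) powr \<theta>"
      using V_diam[OF as] V_bounded[OF as] assms(2) by (intro powr_mono2 diameter_ge_0) auto
    also have "\<dots> = (1 / B ^ (length ?as + 1)) powr \<theta> * real (cden ?as) powr (- 2 * \<theta>)"
    proof -
      have "((real (cden ?as))\<^sup>2) powr \<theta> = real (cden ?as) powr (2 * \<theta>)"
      proof -
        have "((real (cden ?as))\<^sup>2) powr \<theta> = (real (cden ?as) powr 2) powr \<theta>"
          using q by (simp add: powr_numeral)
        then show ?thesis by (simp only: powr_powr)
      qed
      moreover have "(1 / B ^ (length ?as + 1) / (real (cden ?as))\<^sup>2) powr \<theta>
          = (1 / B ^ (length ?as + 1)) powr \<theta> / ((real (cden ?as))\<^sup>2) powr \<theta>"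
        by (rule powr_divide)
      moreover have "real (cden ?as) powr (- 2 * \<theta>) = 1 / real (cden ?as) powr (2 * \<theta>)"
        by (simp add: powr_minus_divide)
      ultimately show ?thesis by simp
    qed
    finally show ?thesis using True by (simp add: h_def)
  qed (simp add: U_def diam_pow_def h_def)
  have finite_bound: "sum h F \<le> e" if F: "finite F" for F
  proof -
    let ?F = "{as \<in> F. ok as}"
    obtain K where K: "length as < K" if "as \<in> F" for as
      using F finite_nat_set_iff_bounded[of "length ` F"] by auto
    have "sum h F = sum h ?F"
      using F by (intro sum.mono_neutral_right) (auto simp: h_def)
    also have "\<dots> = (\<Sum>n\<in>{N..<K}. sum h {as \<in> ?F. length as = n})"
      using F K by (intro sum.group[symmetric]) (auto simp: ok_def)
    also have "\<dots> \<le> sum ?g {N..<K}"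
    proof (rule sum_mono)
      fix n
      have "sum h {as \<in> ?F. length as = n}
          = (\<Sum>as | as \<in> ?F \<and> length as = n. (1 / B ^ (n + 1)) powr \<theta> * real (cden as) powr (- 2 * \<theta>))"
        by (rule sum.cong) (auto simp: h_def)
      also have "\<dots> \<le> ?g n"
        unfolding sum_distrib_left[symmetric] using F assms(2)
        by (intro mult_left_mono denom_sum_ge_finite) (auto simp: pos_tuples_iff ok_def)
      finally show "sum h {as \<in> ?F. length as = n} \<le> ?g n" .
    qed
    also have "\<dots> \<le> e" using N1[of N K] by (simp add: N_def)
    finally show ?thesis .
  qed
  have "(\<Sum>i. ennreal (diam_pow \<theta> (U i))) \<le> ennreal e"
  proof (rule suminf_le_const)
    fix n
    have "(\<Sum>i<n. ennreal (diam_pow \<theta> (U i))) \<le> (\<Sum>i<n. ennreal (h (list_decode i)))"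
      using U_h by (intro sum_mono ennreal_leI)
    also have "\<dots> = ennreal (\<Sum>i<n. h (list_decode i))"
      using h_nonneg by (intro sum_ennreal)
    also have "(\<Sum>i<n. h (list_decode i)) = sum h (list_decode ` {..<n})"
      by (subst sum.reindex) (auto intro: inj_on_subset[OF inj_list_decode])
    also have "ennreal \<dots> \<le> ennreal e" by (intro ennreal_leI finite_bound) simp
    finally show "(\<Sum>i<n. ennreal (diam_pow \<theta> (U i))) \<le> ennreal e" .
  qed simp
  moreover have "hausdorff_content \<theta> \<delta> (large_quotient_set B) \<le> (\<Sum>i. ennreal (diam_pow \<theta> (U i)))"
    unfolding hausdorff_content_def using cover U_small by (intro Inf_lower) blast
  ultimately show ?thesis by (rule order_trans[rotated])
qed

lemma hausdorff_outer_measure_large_quotient_set_eq_0: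
  fixes B :: real
  assumes "B > 1" "\<theta> > 1 / 2" "pressure \<theta> < \<theta> * ln B"
  shows "hausdorff_outer_measure \<theta> (large_quotient_set B) = 0"
proof -
  have "hausdorff_content \<theta> \<delta> (large_quotient_set B) \<le> 0" if "0 < \<delta>" for \<delta>
  proof (rule ennreal_le_epsilon)
    fix e :: real assume "0 < e"
    from hausdorff_content_large_quotient_set_le[OF assms that this]
    show "hausdorff_content \<theta> \<delta> (large_quotient_set B) \<le> 0 + ennreal e" by simp
  qed
  then show ?thesis
    unfolding hausdorff_outer_measure_def by (intro antisym SUP_least) auto
qed

section \<open>Points with prescribed partial quotients\<close>

text \<open>
  The Gauss map sends \<open>a / b\<close> to \<open>(b mod a) / a\<close>, so along the orbit of a rational number the
  denominators would decrease forever.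
\<close>

lemma gauss_orbit_of_rational:
  assumes "x \<in> \<rat>" "\<And>n. (gauss_map ^^ n) x \<in> {0<..<1}"
  shows False
proof -
  have "False" if "x = real a / real b" "\<And>n. (gauss_map ^^ n) x \<in> {0<..<1}" for a b :: nat and x
    using that
  proof (induction b arbitrary: a x rule: less_induct)
    case (less b)
    have "0 < x" "x < 1" using less.prems(2)[of 0] by auto
    then have ab: "0 < a" "a < b" using less.prems(1) by (auto simp: zero_less_divide_iff divide_less_eq_1)
    have "gauss_map x = frac (real b / real a)" using less.prems(1) by (simp add: gauss_map_def)
    also have "real b / real a = of_int (int (b div a)) + real (b mod a) / real a"
    proof -
      have "real b = real (b div a) * real a + real (b mod a)"
        by (metis div_mult_mod_eq of_nat_add of_nat_mult)
      then show ?thesis using ab by (simp add: field_simps)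
    qed
    also have "frac \<dots> = real (b mod a) / real a"
      using ab by (simp add: frac_unique_iff frac_eq)
    finally show False
      using less.IH[OF ab(2), of "gauss_map x" "b mod a"] less.prems(2)[of "Suc n" for n]
      by (simp add: funpow_swap1)
  qed
  moreover obtain a b :: int where "b > 0" "x = of_int a / of_int b"
    using assms(1) by (metis Rats_cases')
  moreover have "a \<ge> 0"
    using calculation assms(2)[of 0] by (auto simp: zero_less_divide_iff)
  ultimately show False
    using assms(2) by (metis nat_0_le of_int_of_nat_eq order_less_imp_le)
qed

text \<open>
  Membership in all closed cylinders of a digit sequence: a condition that compactness provides and
  that the Gauss map carries over to the shifted sequence.
\<close>
definition nested_in :: "real \<Rightarrow> (nat \<Rightarrow> nat) \<Rightarrow> bool" where
  "nested_in x d \<longleftrightarrow> (\<forall>n. x \<in> cf_map (map d [0..<n]) ` {0..1})"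

lemma nested_in_step:
  assumes "nested_in x d" "\<And>i. 1 \<le> d i"
  shows "0 < x" "x < 1" "nat \<lfloor>1 / x\<rfloor> = d 0" "nested_in (gauss_map x) (\<lambda>i. d (Suc i))"
proof -
  have step: "\<exists>y\<in>cf_map (map (\<lambda>i. d (Suc i)) [0..<n]) ` {0..1}. x = 1 / (real (d 0) + y)" for n
  proof -
    have "x \<in> cf_map (map d [0..<Suc n]) ` {0..1}" using assms(1) unfolding nested_in_def by blast
    then show ?thesis unfolding map_upt_Suc by auto
  qed
  \<comment> \<open>Two further digits keep \<open>y\<close> away from the end points 0 and 1 of the closed cylinders.\<close>
  obtain y where y: "y \<in> cf_map (map (\<lambda>i. d (Suc i)) [0..<2]) ` {0..1}" "x = 1 / (real (d 0) + y)"
    using step[of 2] by blast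
  obtain t where t: "0 \<le> t" "t \<le> 1" "y = 1 / (real (d 1) + 1 / (real (d 2) + t))"
    using y(1) by (auto simp: numeral_2_eq_2)
  have d: "1 \<le> real (d i)" for i using assms(2)[of i] by simp
  have "0 < 1 / (real (d 2) + t)" using d[of 2] t by (intro divide_pos_pos) auto
  then have "1 < real (d 1) + 1 / (real (d 2) + t)" using d[of 1] by linarith
  then have y01: "0 < y" "y < 1" using t by auto
  then show "0 < x" "x < 1" using y(2) d[of 0] by auto
  have inv: "1 / x = of_int (int (d 0)) + y" using y by simp
  then have "\<lfloor>1 / x\<rfloor> = int (d 0)" using y01 by (simp add: floor_unique)
  then show "nat \<lfloor>1 / x\<rfloor> = d 0" by simp
  have g: "gauss_map x = y"
    using inv \<open>\<lfloor>1 / x\<rfloor> = int (d 0)\<close> by (simp add: gauss_map_def frac_def)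
  show "nested_in (gauss_map x) (\<lambda>i. d (Suc i))"
    unfolding nested_in_def
  proof
    fix n
    obtain z where z: "z \<in> cf_map (map (\<lambda>i. d (Suc i)) [0..<n]) ` {0..1}" "x = 1 / (real (d 0) + z)"
      using step by blast
    have "1 / x = real (d 0) + z" using z by simp
    then have "z = gauss_map x" using inv g by simp
    then show "gauss_map x \<in> cf_map (map (\<lambda>i. d (Suc i)) [0..<n]) ` {0..1}" using z by simp
  qed
qed

lemma exists_point_with_partial_quotients:
  assumes "\<And>i. 1 \<le> d i"
  shows "\<exists>x\<in>irrational_unit. \<forall>n. partial_quotient (Suc n) x = d n"
proof -
  let ?F = "\<lambda>n. cf_map (map d [0..<n]) ` {0..1}"
  have pl: "pos_list (map d xs)" for xs using assms by (auto simp: pos_list_def)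
  have "continuous_on {0..1} (cf_map as)" if "pos_list as" for as
    using that
  proof (induction as)
    case (Cons a as)
    have "real a + cf_map as t \<noteq> 0" if "t \<in> {0..1}" for t
      using Cons.prems cf_map_nonneg[of t as] that by (auto simp: add_nonneg_eq_0_iff)
    then show ?case using Cons by (auto intro!: continuous_intros)
  qed (simp add: cf_map_def)
  then have "compact (?F n)" for n using pl by (intro compact_continuous_image) auto
  moreover have "?F (Suc n) \<subseteq> ?F n" for n
    using assms[of n] by (force intro!: imageI simp: divide_le_eq_1)
  then have "?F n \<subseteq> ?F m" if "m \<le> n" for m n
    using that by (rule lift_Suc_antimono_le)
  ultimately have "\<Inter> (range ?F) \<noteq> {}" by (intro compact_nest) auto
  then obtain x where "nested_in x d" by (auto simp: nested_in_def)
  then have nested: "nested_in ((gauss_map ^^ n) x) (\<lambda>i. d (i + n))" for n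
  proof (induction n)
    case (Suc n)
    then show ?case using nested_in_step(4)[of "(gauss_map ^^ n) x" "\<lambda>i. d (i + n)"] assms by simp
  qed simp
  have orbit: "(gauss_map ^^ n) x \<in> {0<..<1}" and quot: "partial_quotient (Suc n) x = d n" for n
    using nested_in_step(1,2,3)[OF nested, of n] assms by (auto simp: partial_quotient_def)
  have "x \<notin> \<rat>" using gauss_orbit_of_rational orbit by blast
  then have "x \<in> irrational_unit" using orbit[of 0] by (auto simp: irrational_unit_def)
  then show ?thesis using quot by blast
qed


section \<open>A Cantor subset and its budget\<close>

definition level_word :: "(nat \<Rightarrow> nat list) \<Rightarrow> nat \<Rightarrow> nat list" where
  "level_word \<omega> l = concat (map \<omega> [0..<l])"

lemma level_word_simps [simp]:
  "level_word \<omega> 0 = []" "level_word \<omega> (Suc l) = level_word \<omega> l @ \<omega> l"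
  by (simp_all add: level_word_def)

lemma level_word_cong: "(\<And>i. i < l \<Longrightarrow> \<omega> i = \<omega>' i) \<Longrightarrow> level_word \<omega> l = level_word \<omega>' l"
  by (induction l) auto

lemma powr_power_swap: "0 \<le> x \<Longrightarrow> (x ^ n) powr a = ((x::real) powr a) ^ n"
  by (induction n) (auto simp: powr_mult)

text \<open>
  A free level consists of a word of \<open>W\<close> preceded by the digit 2 and so has \<open>m + 1\<close> digits. The
  assumption \<open>gain\<close> says that the weight \<open>Z\<close> pays for \<open>m + 1\<close> factors \<open>B\<^sup>s\<close> and for the constant
  \<open>36\<^sup>s\<close> lost in gluing the word to its predecessors, and still leaves a factor 2.
\<close>
locale cantor_scheme =
  fixes B s Z :: real and m :: nat and W :: "nat list set"
  assumes B: "1 < B" and s: "1 / 2 < s" "s \<le> 1" and m: "1 \<le> m"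
    and W: "finite W" "W \<subseteq> pos_tuples m"
    and Z: "Z = (\<Sum>w\<in>W. real (cden w) powr (- 2 * s))"
    and gain: "2 * 36 powr s \<le> Z * (B ^ (m + 1)) powr (- s)"
begin

text \<open>
  The lower end of the range of the large quotient on level \<open>l\<close>. No word has more than \<open>m + 1\<close> digits, so
  this quotient stands at position \<open>(m + 1) * (l + 1)\<close> or earlier.
\<close>
definition base :: "nat \<Rightarrow> nat" where
  "base l = nat \<lceil>B ^ ((m + 1) * (l + 1))\<rceil>"

text \<open>
  A bound for (mass of a cylinder of level \<open>l\<close>) \<open>\<times> q\<^sup>2\<^sup>s\<close>. The positions of the large quotients are not
  fixed in advance: a level is big exactly when the budget is at most \<open>\<beta>\<^sup>-\<^sup>s\<close>. This is the condition
  under which a cylinder, shrunk to the part where the next quotient is at least \<open>\<beta>\<close>, still has mass at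
  most (diameter)\<open>\<^sup>s\<close> up to a constant.
\<close>
fun budget :: "nat \<Rightarrow> real" where
  "budget 0 = 1"
| "budget (Suc l) =
     (if budget l \<le> real (base l) powr (- s) then 144 powr s * real (base l) powr (2 * s - 1) * budget l
      else 36 powr s / Z * budget l)"

definition big :: "nat \<Rightarrow> bool" where
  "big l \<longleftrightarrow> budget l \<le> real (base l) powr (- s)"

definition level_words :: "nat \<Rightarrow> nat list set" where
  "level_words l = (if big l then (\<lambda>b. [2, b]) ` {base l..<2 * base l} else (\<lambda>w. 2 # w) ` W)"

definition weight :: "nat \<Rightarrow> nat list \<Rightarrow> real" where
  "weight l u = (if big l then 1 / real (base l) else real (cden (tl u)) powr (- 2 * s) / Z)"

lemma base_ge: "B ^ ((m + 1) * (l + 1)) \<le> real (base l)"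
  unfolding base_def by (rule real_nat_ceiling_ge)

lemma base_le: "real (base l) \<le> 2 * B ^ ((m + 1) * (l + 1))"
proof -
  have 1: "1 \<le> B ^ ((m + 1) * (l + 1))" using B by (intro one_le_power) auto
  have "real (base l) = of_int \<lceil>B ^ ((m + 1) * (l + 1))\<rceil>"
    unfolding base_def using 1 by (intro of_nat_nat) (simp add: order_trans[OF _ 1] le_ceiling_iff)
  then show ?thesis using 1 of_int_ceiling_le_add_one[of "B ^ ((m + 1) * (l + 1))"] by linarith
qed

lemma base_pos: "0 < base l"
proof -
  have "0 < B ^ ((m + 1) * (l + 1))" using B by simp
  then have "0 < real (base l)" using base_ge by (rule less_le_trans)
  then show ?thesis by simp
qed

lemma Z_pos: "0 < Z"
proof -
  have "0 < 2 * 36 powr s" by simp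
  then have "0 < Z * (B ^ (m + 1)) powr (- s)" using gain by (rule less_le_trans)
  then show ?thesis by (simp add: zero_less_mult_iff)
qed

lemma shrink_le: "36 powr s / Z \<le> (B ^ (m + 1)) powr (- s) / 2"
  using gain Z_pos by (simp add: field_simps)

lemma shrink_le_1: "36 powr s / Z \<le> 1"
proof -
  have "(B ^ (m + 1)) powr (- s) \<le> 1 powr (- s)"
    using B s one_le_power[of B "m + 1"] by (intro powr_mono2') auto
  then show ?thesis using shrink_le by (simp only: powr_one_eq_one)
qed

lemma budget_pos: "0 < budget l"
  using Z_pos base_pos by (induction l) auto

text \<open>
  A big level multiplies the budget by \<open>144\<^sup>s \<beta>\<^sup>2\<^sup>s\<^sup>-\<^sup>1\<close>, but starts from at most \<open>\<beta>\<^sup>-\<^sup>s\<close>. The product is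
  \<open>144\<^sup>s \<beta>\<^sup>s\<^sup>-\<^sup>1\<close>, which is bounded because \<open>s \<le> 1\<close>.
\<close>
lemma budget_le: "budget l \<le> 144 powr s"
proof (induction l)
  case 0
  have "1 powr s \<le> 144 powr s" using s by (intro powr_mono2) auto
  then show ?case by simp
next
  case (Suc l)
  show ?case
  proof (cases "budget l \<le> real (base l) powr (- s)")
    case True
    have "real (base l) powr (2 * s - 1) * budget l \<le> real (base l) powr (2 * s - 1) * real (base l) powr (- s)"
      using True by (intro mult_left_mono) auto
    also have "\<dots> = real (base l) powr (s - 1)"
      by (simp add: powr_add[symmetric])
    also have "\<dots> \<le> real (base l) powr 0"
      using base_pos[of l] s by (intro powr_mono) auto
    also have "\<dots> = 1" using base_pos[of l] by simp
    finally have "144 powr s * (real (base l) powr (2 * s - 1) * budget l) \<le> 144 powr s * 1"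
      by (intro mult_left_mono) auto
    then show ?thesis using True by (simp add: mult.assoc)
  next
    case False
    have "36 powr s / Z * budget l \<le> 1 * budget l"
      using shrink_le_1 budget_pos[of l] by (intro mult_right_mono) auto
    then show ?thesis using False Suc by simp
  qed
qed

text \<open>
  On a run of free levels the budget falls by the factor \<open>B\<^sup>-\<^sup>s\<^sup>(\<^sup>m\<^sup>+\<^sup>1\<^sup>) / 2\<close> per level, while \<open>\<beta>\<^sup>-\<^sup>s\<close> falls only
  by about \<open>B\<^sup>-\<^sup>s\<^sup>(\<^sup>m\<^sup>+\<^sup>1\<^sup>)\<close>; so the threshold is reached.
\<close>
lemma infinitely_many_big: "\<exists>l\<ge>l0. big l"
proof (rule ccontr)
  assume no: "\<not> (\<exists>l\<ge>l0. big l)"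
  let ?r = "(B ^ (m + 1)) powr (- s)"
  have r: "0 < ?r" using B by simp
  have le: "budget (l0 + k) \<le> (?r / 2) ^ k * budget l0" for k
  proof (induction k)
    case (Suc k)
    have "budget (l0 + Suc k) = 36 powr s / Z * budget (l0 + k)"
      using no by (auto simp: big_def)
    also have "\<dots> \<le> ?r / 2 * ((?r / 2) ^ k * budget l0)"
      using shrink_le Suc r budget_pos Z_pos by (intro mult_mono) (auto simp: less_imp_le)
    finally show ?case by simp
  qed simp
  have ge: "2 powr (- s) * ?r ^ (l0 + k + 1) \<le> budget (l0 + k)" for k
  proof -
    have "2 powr (- s) * ?r ^ (l0 + k + 1) = (2 * (B ^ (m + 1)) ^ (l0 + k + 1)) powr (- s)"
      using B by (simp add: powr_mult powr_power_swap)
    also have "\<dots> = (2 * B ^ ((m + 1) * (l0 + k + 1))) powr (- s)"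
      by (simp only: power_mult)
    also have "\<dots> \<le> real (base (l0 + k)) powr (- s)"
      using base_le[of "l0 + k"] base_pos[of "l0 + k"] s by (intro powr_mono2') auto
    also have "\<dots> \<le> budget (l0 + k)" using no by (meson big_def le_add1 linear)
    finally show ?thesis .
  qed
  define c where "c = 2 powr (- s) * ?r ^ (l0 + 1)"
  have c: "0 < c" using r by (simp add: c_def)
  have "c \<le> budget l0 * (1 / 2) ^ k" for k
  proof -
    have "c * ?r ^ k \<le> (?r / 2) ^ k * budget l0"
      using order_trans[OF ge le, of k] by (simp add: c_def power_add mult.assoc mult.commute mult.left_commute)
    then have "c * ?r ^ k \<le> (budget l0 * (1 / 2) ^ k) * ?r ^ k"
      by (simp add: power_divide power_one_over field_simps)
    then show ?thesis using r by simp
  qed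
  moreover have "(\<lambda>k. budget l0 * (1 / 2) ^ k) \<longlonglongrightarrow> budget l0 * 0"
    by (intro tendsto_intros) auto
  ultimately have "c \<le> budget l0 * 0" by (intro LIMSEQ_le_const) auto
  then show False using c by simp
qed

lemma W_word: "w \<in> W \<Longrightarrow> length w = m \<and> pos_list w"
  using W by (auto simp: pos_tuples_iff)

lemma level_words_finite: "finite (level_words l)"
  using W by (simp add: level_words_def)

lemma level_word_shape:
  assumes "u \<in> level_words l"
  shows "pos_list u" "u \<noteq> []" "hd u = 2" "length u \<le> m + 1" "u' \<in> level_words l \<Longrightarrow> length u = length u'"
    "2 \<le> cden u"
proof -
  have [simp]: "Suc 0 \<le> b" if "base l \<le> b" for b using base_pos[of l] that by linarith
  show pl: "pos_list u" using assms by (auto simp: level_words_def W_word split: if_splits)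
  show ne: "u \<noteq> []" "hd u = 2" "length u \<le> m + 1" using assms m by (auto simp: level_words_def W_word split: if_splits)
  show "u' \<in> level_words l \<Longrightarrow> length u = length u'" using assms by (auto simp: level_words_def W_word split: if_splits)
  obtain v where v: "u = 2 # v" using ne by (cases u) auto
  then have "1 \<le> cden v" using pl cden_pos[of v] by simp
  then show "2 \<le> cden u" using v by simp
qed

lemma weight_nonneg: "0 \<le> weight l u"
  using Z_pos by (simp add: weight_def)

lemma sum_weight: "(\<Sum>u\<in>level_words l. weight l u) = 1"
proof (cases "big l")
  case True
  have "(\<Sum>u\<in>level_words l. weight l u) = (\<Sum>b\<in>{base l..<2 * base l}. 1 / real (base l))"
    unfolding level_words_def weight_def using True by (simp only: if_True) (subst sum.reindex, auto simp: inj_on_def)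
  then show ?thesis using base_pos[of l] by simp
next
  case False
  have "(\<Sum>u\<in>level_words l. weight l u) = (\<Sum>w\<in>W. real (cden w) powr (- 2 * s) / Z)"
    unfolding level_words_def weight_def using False by (simp only: if_False) (subst sum.reindex, auto simp: inj_on_def)
  also have "\<dots> = Z / Z" unfolding Z by (rule sum_divide_distrib[symmetric])
  finally show ?thesis using Z_pos by simp
qed

text \<open>
  Appending the word \<open>u\<close> multiplies \<open>q\<close> by at most \<open>2 q\<^sub>u\<close>. On a big level \<open>q\<^sub>u = 2 b + 1 \<le> 6 \<beta>\<close>, on a free
  level \<open>q\<^sub>u \<le> 3 q\<^sub>w\<close>: these are the sources of the constants \<open>144 = 12\<^sup>2\<close> and \<open>36 = 6\<^sup>2\<close>.
\<close>
lemma weight_step: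
  assumes "u \<in> level_words l"
  shows "weight l u * (2 * real (cden u)) powr (2 * s) * budget l \<le> budget (Suc l)"
proof (cases "big l")
  case True
  then obtain b where b: "u = [2, b]" "base l \<le> b" "b < 2 * base l"
    using assms by (auto simp: level_words_def)
  have "2 * real (cden u) \<le> 12 * real (base l)" using b by simp
  then have "(2 * real (cden u)) powr (2 * s) \<le> (12 * real (base l)) powr (2 * s)"
    using s by (intro powr_mono2) auto
  also have "\<dots> = 144 powr s * real (base l) powr (2 * s)"
  proof -
    have "(12::real) powr (2 * s) = (12 powr 2) powr s" by (simp only: powr_powr)
    then show ?thesis by (simp add: powr_mult)
  qed
  finally have "weight l u * (2 * real (cden u)) powr (2 * s)
      \<le> 1 / real (base l) * (144 powr s * real (base l) powr (2 * s))"
    unfolding weight_def using True by (auto intro!: divide_right_mono)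
  also have "\<dots> = 144 powr s * real (base l) powr (2 * s - 1)"
    using base_pos[of l] by (simp add: powr_diff)
  finally have "weight l u * (2 * real (cden u)) powr (2 * s) * budget l
      \<le> 144 powr s * real (base l) powr (2 * s - 1) * budget l"
    using budget_pos[of l] by (intro mult_right_mono) auto
  then show ?thesis using True by (simp add: big_def)
next
  case False
  then obtain w where w: "u = 2 # w" "w \<in> W" using assms by (auto simp: level_words_def)
  have q: "0 < real (cden w)" using W_word[OF w(2)] cden_pos by simp
  have "2 * real (cden u) \<le> 6 * real (cden w)"
    using cnum_le_cden[of w] W_word[OF w(2)] w by simp
  then have "(2 * real (cden u)) powr (2 * s) \<le> (6 * real (cden w)) powr (2 * s)"
    using s by (intro powr_mono2) auto
  also have "\<dots> = 36 powr s * real (cden w) powr (2 * s)"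
  proof -
    have "(6::real) powr (2 * s) = (6 powr 2) powr s" by (simp only: powr_powr)
    then show ?thesis by (simp add: powr_mult)
  qed
  finally have "weight l u * (2 * real (cden u)) powr (2 * s)
      \<le> real (cden w) powr (- 2 * s) / Z * (36 powr s * real (cden w) powr (2 * s))"
    using False w Z_pos by (intro mult_mono) (auto simp: weight_def)
  also have "\<dots> = 36 powr s / Z * (real (cden w) powr (- 2 * s) * real (cden w) powr (2 * s))" by simp
  also have "real (cden w) powr (- 2 * s) * real (cden w) powr (2 * s) = 1"
    using q by (simp add: powr_add[symmetric])
  finally have "weight l u * (2 * real (cden u)) powr (2 * s) * budget l \<le> 36 powr s / Z * budget l"
    using budget_pos[of l] by (intro mult_right_mono) auto
  then show ?thesis using False by (simp add: big_def)
qed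

definition codes :: "(nat \<Rightarrow> nat list) set" where
  "codes = {\<omega>. \<forall>l. \<omega> l \<in> level_words l}"

definition mass :: "(nat \<Rightarrow> nat list) \<Rightarrow> nat \<Rightarrow> real" where
  "mass \<omega> l = (\<Prod>i<l. weight i (\<omega> i))"

lemma codesD: "\<omega> \<in> codes \<Longrightarrow> \<omega> l \<in> level_words l"
  by (simp add: codes_def)

lemma pos_list_level_word: "\<omega> \<in> codes \<Longrightarrow> pos_list (level_word \<omega> l)"
  by (induction l) (auto dest: codesD level_word_shape)

lemma mass_nonneg: "0 \<le> mass \<omega> l"
  unfolding mass_def by (intro prod_nonneg) (simp add: weight_nonneg)

lemma mass_le_budget:
  assumes "\<omega> \<in> codes"
  shows "mass \<omega> l * real (cden (level_word \<omega> l)) powr (2 * s) \<le> budget l"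
proof (induction l)
  case (Suc l)
  let ?v = "level_word \<omega> l" and ?u = "\<omega> l"
  have u: "?u \<in> level_words l" by (rule codesD[OF assms])
  have "cden (?v @ ?u) \<le> 2 * (cden ?v * cden ?u)"
    using pos_list_level_word[OF assms] level_word_shape(1)[OF u] by (rule cden_append_le)
  then have "real (cden (?v @ ?u)) \<le> real (cden ?v) * (2 * real (cden ?u))"
    by (metis mult.left_commute of_nat_le_iff of_nat_mult of_nat_numeral)
  then have "real (cden (?v @ ?u)) powr (2 * s) \<le> (real (cden ?v) * (2 * real (cden ?u))) powr (2 * s)"
    using s by (intro powr_mono2) auto
  also have "\<dots> = real (cden ?v) powr (2 * s) * (2 * real (cden ?u)) powr (2 * s)"
    by (rule powr_mult)
  finally have "mass \<omega> (Suc l) * real (cden (level_word \<omega> (Suc l))) powr (2 * s)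
      \<le> mass \<omega> (Suc l) * (real (cden ?v) powr (2 * s) * (2 * real (cden ?u)) powr (2 * s))"
    using mass_nonneg by (simp add: mult_left_mono)
  also have "\<dots> = weight l ?u * (2 * real (cden ?u)) powr (2 * s) * (mass \<omega> l * real (cden ?v) powr (2 * s))"
    by (simp add: mass_def)
  also have "\<dots> \<le> weight l ?u * (2 * real (cden ?u)) powr (2 * s) * budget l"
    using Suc weight_nonneg by (intro mult_left_mono) auto
  also have "\<dots> \<le> budget (Suc l)" by (rule weight_step[OF u])
  finally show ?case .
qed (simp add: mass_def)

lemma mass_le:
  assumes "\<omega> \<in> codes"
  shows "mass \<omega> l \<le> budget l * real (cden (level_word \<omega> l)) powr (- 2 * s)"
proof -
  have q: "0 < real (cden (level_word \<omega> l))"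
    using cden_pos[OF pos_list_level_word[OF assms]] by simp
  have "mass \<omega> l * real (cden (level_word \<omega> l)) powr (2 * s) * real (cden (level_word \<omega> l)) powr (- 2 * s)
      \<le> budget l * real (cden (level_word \<omega> l)) powr (- 2 * s)"
    using mass_le_budget[OF assms] by (intro mult_right_mono) auto
  then show ?thesis using q by (simp add: mult.assoc powr_add[symmetric])
qed

lemma cden_level_word_ge:
  assumes "\<omega> \<in> codes"
  shows "2 ^ l \<le> cden (level_word \<omega> l)"
proof (induction l)
  case (Suc l)
  have "2 ^ l * 2 \<le> cden (level_word \<omega> l) * cden (\<omega> l)"
    using Suc level_word_shape(6)[OF codesD[OF assms]] by (rule mult_le_mono)
  also have "\<dots> \<le> cden (level_word \<omega> (Suc l))" using cden_append_ge by simp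
  finally show ?case by simp
qed simp

lemma mass_le_geometric:
  assumes "\<omega> \<in> codes"
  shows "mass \<omega> l \<le> 144 powr s * (1 / 2) ^ l"
proof -
  let ?q = "real (cden (level_word \<omega> l))"
  have q: "2 ^ l \<le> ?q"
    using cden_level_word_ge[OF assms, of l] by (metis of_nat_le_iff of_nat_numeral of_nat_power)
  then have "?q powr (- 2 * s) \<le> (2 ^ l) powr (- 2 * s)"
    using s by (intro powr_mono2') auto
  also have "\<dots> \<le> (2 ^ l) powr (- 1)" using s by (intro powr_mono) auto
  also have "\<dots> = (1 / 2) ^ l" by (simp add: powr_minus_divide power_one_over)
  finally have "budget l * ?q powr (- 2 * s) \<le> 144 powr s * (1 / 2) ^ l"
    using budget_le[of l] budget_pos[of l] by (intro mult_mono) auto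
  then show ?thesis using mass_le[OF assms, of l] by linarith
qed

section \<open>Points coded by words\<close>

definition digit :: "(nat \<Rightarrow> nat list) \<Rightarrow> nat \<Rightarrow> nat" where
  "digit \<omega> k = level_word \<omega> (Suc k) ! k"

lemma length_level_word_ge: "\<omega> \<in> codes \<Longrightarrow> l \<le> length (level_word \<omega> l)"
proof (induction l)
  case (Suc l)
  have "0 < length (\<omega> l)" using level_word_shape(2)[OF codesD[OF Suc.prems]] by simp
  moreover have "length (level_word \<omega> (Suc l)) = length (level_word \<omega> l) + length (\<omega> l)" by simp
  ultimately show ?case using Suc by linarith
qed simp

lemma length_level_word_le: "\<omega> \<in> codes \<Longrightarrow> length (level_word \<omega> l) \<le> (m + 1) * l"
proof (induction l)
  case (Suc l)
  then show ?case using level_word_shape(4)[OF codesD[OF Suc.prems, of l]] by simp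
qed simp

lemma level_word_nth_mono:
  "l \<le> l' \<Longrightarrow> k < length (level_word \<omega> l) \<Longrightarrow> level_word \<omega> l' ! k = level_word \<omega> l ! k \<and> k < length (level_word \<omega> l')"
  by (induction l' rule: dec_induct) (auto simp: nth_append)

lemma level_word_nth:
  assumes "\<omega> \<in> codes" "k < length (level_word \<omega> l)"
  shows "level_word \<omega> l ! k = digit \<omega> k"
proof -
  have "k < length (level_word \<omega> (Suc k))" using length_level_word_ge[OF assms(1), of "Suc k"] by linarith
  then show ?thesis
    using level_word_nth_mono[of l "max l (Suc k)" k \<omega>] level_word_nth_mono[of "Suc k" "max l (Suc k)" k \<omega>] assms
    unfolding digit_def by (metis max.cobounded1 max.cobounded2)
qed

lemma level_word_eq_map_digit:
  "\<omega> \<in> codes \<Longrightarrow> level_word \<omega> l = map (digit \<omega>) [0..<length (level_word \<omega> l)]"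
  by (rule nth_equalityI) (auto simp: level_word_nth)

lemma digit_at_level:
  assumes "\<omega> \<in> codes" "j < length (\<omega> l)"
  shows "digit \<omega> (length (level_word \<omega> l) + j) = \<omega> l ! j"
  using level_word_nth[OF assms(1), of "length (level_word \<omega> l) + j" "Suc l"] assms(2)
  by (simp add: nth_append)

lemma digit_pos:
  assumes "\<omega> \<in> codes"
  shows "1 \<le> digit \<omega> k"
proof -
  have "k < length (level_word \<omega> (Suc k))" using length_level_word_ge[OF assms, of "Suc k"] by linarith
  then have "digit \<omega> k \<in> set (level_word \<omega> (Suc k))" unfolding digit_def by (rule nth_mem)
  then show ?thesis using pos_list_level_word[OF assms] unfolding pos_list_def by blast
qed

definition point :: "(nat \<Rightarrow> nat list) \<Rightarrow> real" where
  "point \<omega> = (SOME x. x \<in> irrational_unit \<and> (\<forall>n. partial_quotient (Suc n) x = digit \<omega> n))"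

definition tail :: "(nat \<Rightarrow> nat list) \<Rightarrow> nat \<Rightarrow> real" where
  "tail \<omega> l = (gauss_map ^^ length (level_word \<omega> l)) (point \<omega>)"

lemma point:
  assumes "\<omega> \<in> codes"
  shows "point \<omega> \<in> irrational_unit" "partial_quotient (Suc n) (point \<omega>) = digit \<omega> n"
proof -
  have "\<exists>x. x \<in> irrational_unit \<and> (\<forall>n. partial_quotient (Suc n) x = digit \<omega> n)"
    using exists_point_with_partial_quotients[of "digit \<omega>"] digit_pos[OF assms] by blast
  then have "point \<omega> \<in> irrational_unit \<and> (\<forall>n. partial_quotient (Suc n) (point \<omega>) = digit \<omega> n)"
    unfolding point_def by (rule someI_ex)
  then show "point \<omega> \<in> irrational_unit" "partial_quotient (Suc n) (point \<omega>) = digit \<omega> n" by auto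
qed

lemma point_eq_tail:
  assumes "\<omega> \<in> codes"
  shows "point \<omega> = cf_map (level_word \<omega> l) (tail \<omega> l)"
  using cf_map_partial_quotients[OF point(1)[OF assms], of "length (level_word \<omega> l)"] point(2)[OF assms]
    level_word_eq_map_digit[OF assms, of l]
  by (simp add: tail_def)

text \<open>
  Every word starts with the digit 2. This keeps the remainders away from 0 and 1, so that cylinders
  of different words on one level are separated by gaps.
\<close>
lemma tail_bounds:
  assumes "\<omega> \<in> codes"
  shows "1 / 3 \<le> tail \<omega> l" "tail \<omega> l \<le> 1 / 2"
proof -
  let ?n = "length (level_word \<omega> l)"
  have irr: "tail \<omega> l \<in> irrational_unit"
    unfolding tail_def by (rule gauss_map_funpow_irrational_unit[OF point(1)[OF assms]])
  then have pos: "0 < tail \<omega> l" using irrational_unit_pos by blast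
  have "partial_quotient (Suc ?n) (point \<omega>) = 2"
    using point(2)[OF assms, of ?n] digit_at_level[OF assms, of 0 l] level_word_shape(2,3)[OF codesD[OF assms], of l]
    by (simp add: hd_conv_nth)
  then have "nat \<lfloor>1 / tail \<omega> l\<rfloor> = 2" by (simp add: partial_quotient_def tail_def)
  then have "\<lfloor>1 / tail \<omega> l\<rfloor> = 2" by linarith
  then have "2 \<le> 1 / tail \<omega> l" "1 / tail \<omega> l < 3" by linarith+
  then show "1 / 3 \<le> tail \<omega> l" "tail \<omega> l \<le> 1 / 2" using pos by (auto simp: field_simps)
qed

lemma tail_step:
  assumes "\<omega> \<in> codes"
  shows "tail \<omega> l = cf_map (\<omega> l) (tail \<omega> (Suc l))"
proof -
  have t: "0 < tail \<omega> i" "tail \<omega> i < 1" for i using tail_bounds[OF assms, of i] by auto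
  have u: "0 < cf_map (\<omega> l) (tail \<omega> (Suc l))" "cf_map (\<omega> l) (tail \<omega> (Suc l)) < 1"
    using t level_word_shape(1)[OF codesD[OF assms]] by (auto intro: cf_map_pos cf_map_less_1)
  have "cf_map (level_word \<omega> l) (tail \<omega> l) = cf_map (level_word \<omega> l) (cf_map (\<omega> l) (tail \<omega> (Suc l)))"
    using point_eq_tail[OF assms, of l] point_eq_tail[OF assms, of "Suc l"] by simp
  then show ?thesis
    using cf_map_inj[OF refl pos_list_level_word[OF assms] pos_list_level_word[OF assms] t u] by blast
qed

lemma point_in_large_quotient_set:
  assumes "\<omega> \<in> codes"
  shows "point \<omega> \<in> large_quotient_set B"
proof -
  have "\<exists>n>k. 1 \<le> n \<and> B ^ n \<le> real (partial_quotient n (point \<omega>))" for k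
  proof -
    obtain l where l: "k \<le> l" "big l" using infinitely_many_big by blast
    let ?n = "length (level_word \<omega> l)"
    obtain b where b: "\<omega> l = [2, b]" "base l \<le> b"
      using codesD[OF assms, of l] l(2) by (auto simp: level_words_def)
    have "B ^ (?n + 2) \<le> B ^ ((m + 1) * (l + 1))"
      using B length_level_word_le[OF assms, of l] m by (intro power_increasing) auto
    also have "\<dots> \<le> real b" using base_ge[of l] b(2) by linarith
    also have "b = partial_quotient (Suc (?n + 1)) (point \<omega>)"
      using point(2)[OF assms, of "?n + 1"] digit_at_level[OF assms, of 1 l] b by simp
    finally have "B ^ (?n + 2) \<le> real (partial_quotient (?n + 2) (point \<omega>))" by simp
    then show ?thesis
      using length_level_word_ge[OF assms, of l] l(1) by (intro exI[of _ "?n + 2"]) auto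
  qed
  then show ?thesis
    using point(1)[OF assms] by (auto simp: large_quotient_set_def infinite_nat_iff_unbounded)
qed

section \<open>The mass distribution\<close>

definition level_measure :: "nat \<Rightarrow> nat list measure" where
  "level_measure l = point_measure (level_words l) (\<lambda>u. ennreal (weight l u))"

definition code_measure :: "(nat \<Rightarrow> nat list) measure" where
  "code_measure = PiM UNIV level_measure"

lemma emeasure_level_measure:
  "T \<subseteq> level_words l \<Longrightarrow> emeasure (level_measure l) T = ennreal (\<Sum>u\<in>T. weight l u)"
  unfolding level_measure_def
  by (subst emeasure_point_measure_finite) (auto simp: level_words_finite weight_nonneg intro!: sum_ennreal)

lemma product_prob_space_level_measure: "product_prob_space level_measure"
proof -
  interpret prob_space "level_measure l" for l
  proof
    have "space (level_measure l) = level_words l" by (simp add: level_measure_def space_point_measure)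
    then show "emeasure (level_measure l) (space (level_measure l)) = 1"
      by (simp add: emeasure_level_measure sum_weight)
  qed
  show ?thesis by unfold_locales
qed

lemma space_code_measure: "space code_measure = codes"
  by (auto simp: code_measure_def space_PiM level_measure_def space_point_measure codes_def PiE_def extensional_def)

lemma prob_space_code_measure: "prob_space code_measure"
proof -
  interpret product_prob_space level_measure UNIV by (rule product_prob_space_level_measure)
  show ?thesis unfolding code_measure_def by unfold_locales
qed

lemma cylinder:
  assumes \<omega>0: "\<omega>0 \<in> codes" and T: "T \<subseteq> level_words l"
  defines "D \<equiv> {\<omega>\<in>codes. (\<forall>i<l. \<omega> i = \<omega>0 i) \<and> \<omega> l \<in> T}"
  shows "D \<in> sets code_measure" "emeasure code_measure D = ennreal (mass \<omega>0 l * (\<Sum>u\<in>T. weight l u))"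
proof -
  interpret product_prob_space level_measure UNIV by (rule product_prob_space_level_measure)
  define X where "X i = (if i < l then {\<omega>0 i} else T)" for i
  have X: "X i \<subseteq> level_words i" if "i \<in> {..l}" for i
    using that T codesD[OF \<omega>0] by (auto simp: X_def)
  then have X_sets: "X i \<in> sets (level_measure i)" if "i \<in> {..l}" for i
    using that by (simp add: level_measure_def sets_point_measure)
  have D: "D = {\<omega>\<in>space code_measure. \<forall>i\<in>{..l}. \<omega> i \<in> X i}"
    unfolding space_code_measure D_def X_def by (auto simp: le_less)
  have "{\<omega>\<in>space code_measure. \<forall>i\<in>{..l}. \<omega> i \<in> X i} = prod_emb UNIV level_measure {..l} (Pi\<^sub>E {..l} X)"
    unfolding prod_emb_def code_measure_def using X by (auto simp: space_PiM Pi_iff)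
  then show "D \<in> sets code_measure"
    unfolding D code_measure_def using X_sets by (simp add: sets_PiM_I)
  have "emeasure code_measure D = (\<Prod>i\<in>{..l}. emeasure (level_measure i) (X i))"
    unfolding D unfolding code_measure_def by (rule emeasure_PiM_Collect) (use X_sets in auto)
  also have "\<dots> = (\<Prod>i\<in>{..l}. ennreal (\<Sum>u\<in>X i. weight i u))"
    using X by (intro prod.cong refl emeasure_level_measure) auto
  also have "\<dots> = ennreal (\<Prod>i\<in>{..l}. \<Sum>u\<in>X i. weight i u)"
    by (intro prod_ennreal sum_nonneg weight_nonneg)
  also have "{..l} = insert l {..<l}" by auto
  also have "(\<Prod>i\<in>insert l {..<l}. \<Sum>u\<in>X i. weight i u) = (\<Sum>u\<in>T. weight l u) * mass \<omega>0 l"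
    by (simp add: X_def mass_def)
  finally show "emeasure code_measure D = ennreal (mass \<omega>0 l * (\<Sum>u\<in>T. weight l u))"
    by (simp add: mult.commute)
qed

lemma code_null_set:
  assumes "\<omega>0 \<in> codes"
  shows "{\<omega>0} \<in> sets code_measure" "emeasure code_measure {\<omega>0} = 0"
proof -
  define D where "D l = {\<omega>\<in>codes. (\<forall>i<l. \<omega> i = \<omega>0 i) \<and> \<omega> l \<in> level_words l}" for l
  have D_sets: "D l \<in> sets code_measure" and D_measure: "emeasure code_measure (D l) = ennreal (mass \<omega>0 l)" for l
    unfolding D_def
    by (rule cylinder(1)[OF assms order_refl])
       (simp only: cylinder(2)[OF assms order_refl] sum_weight mult_1_right)
  have eq: "{\<omega>0} = (\<Inter>l. D l)"
  proof
    show "(\<Inter>l. D l) \<subseteq> {\<omega>0}"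
    proof
      fix \<omega> assume "\<omega> \<in> (\<Inter>l. D l)"
      then have "\<omega> \<in> D (Suc i)" for i by blast
      then have "\<omega> i = \<omega>0 i" for i unfolding D_def by blast
      then show "\<omega> \<in> {\<omega>0}" by auto
    qed
  qed (use assms in \<open>auto simp: D_def codesD\<close>)
  show sets: "{\<omega>0} \<in> sets code_measure" unfolding eq using D_sets by auto
  have le: "emeasure code_measure {\<omega>0} \<le> ennreal (144 powr s * (1 / 2) ^ l)" for l
  proof -
    have "emeasure code_measure {\<omega>0} \<le> emeasure code_measure (D l)"
      using D_sets eq by (intro emeasure_mono) auto
    also have "\<dots> \<le> ennreal (144 powr s * (1 / 2) ^ l)"
      unfolding D_measure by (intro ennreal_leI mass_le_geometric assms)
    finally show ?thesis .
  qed
  have "(\<lambda>l. 144 powr s * (1 / 2) ^ l) \<longlonglongrightarrow> 144 powr s * 0"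
    by (intro tendsto_intros) auto
  then have "(\<lambda>l. ennreal (144 powr s * (1 / 2) ^ l)) \<longlonglongrightarrow> ennreal (144 powr s * 0)"
    by (rule tendsto_ennrealI)
  then have "emeasure code_measure {\<omega>0} \<le> ennreal (144 powr s * 0)"
    by (rule LIMSEQ_le_const) (use le in auto)
  then show "emeasure code_measure {\<omega>0} = 0" by simp
qed

text \<open>
  There are finitely many free words, and the compact sets that they define are pairwise disjoint by
  uniqueness of the expansion. The same \<open>W\<close> serves all free levels, which makes the gap uniform.
\<close>
lemma free_words_separated:
  "\<exists>c>0. \<forall>l u u' t t'. \<not> big l \<longrightarrow> u \<in> level_words l \<longrightarrow> u' \<in> level_words l \<longrightarrow> u \<noteq> u' \<longrightarrow>
     t \<in> {1 / 3..1 / 2} \<longrightarrow> t' \<in> {1 / 3..1 / 2} \<longrightarrow> c \<le> \<bar>cf_map u t - cf_map u' t'\<bar>"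
proof -
  let ?I = "{1 / 3..1 / 2 :: real}" and ?V = "(\<lambda>w. 2 # w) ` W"
  define P where "P = {(u, u'). u \<in> ?V \<and> u' \<in> ?V \<and> u \<noteq> u'}"
  have "finite P"
    by (rule finite_subset[of _ "?V \<times> ?V"]) (use W in \<open>auto simp: P_def\<close>)
  have "\<exists>c>0. \<forall>x\<in>cf_map u ` ?I. \<forall>y\<in>cf_map u' ` ?I. c \<le> dist x y" if P: "(u, u') \<in> P" for u u'
  proof (rule separate_compact_closed)
    have pl: "pos_list u" "pos_list u'" "length u = length u'" "u \<noteq> u'"
      using P by (auto simp: P_def W_word)
    have "continuous_on ?I (cf_map v)" if "pos_list v" for v
    proof (rule continuous_onI)
      fix x e :: real assume x: "x \<in> ?I" and e: "0 < e"
      show "\<exists>d>0. \<forall>x'\<in>?I. dist x' x < d \<longrightarrow> dist (cf_map v x') (cf_map v x) \<le> e"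
      proof (intro exI[of _ e] conjI ballI impI e)
        fix x' assume x': "x' \<in> ?I" "dist x' x < e"
        have "\<bar>cf_map v x' - cf_map v x\<bar> \<le> \<bar>x' - x\<bar> / (real (cden v))\<^sup>2"
          using x x' that by (intro cf_map_dist_le) auto
        also have "\<dots> \<le> \<bar>x' - x\<bar> / 1"
          using cden_pos[OF that] by (intro divide_left_mono) auto
        finally show "dist (cf_map v x') (cf_map v x) \<le> e" using x' by (simp add: dist_real_def)
      qed
    qed
    then show "compact (cf_map u ` ?I)" "closed (cf_map u' ` ?I)"
      using pl by (auto intro!: compact_continuous_image compact_imp_closed)
    show "cf_map u ` ?I \<inter> cf_map u' ` ?I = {}"
    proof (rule ccontr)
      assume "cf_map u ` ?I \<inter> cf_map u' ` ?I \<noteq> {}"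
      then obtain t t' where "t \<in> ?I" "t' \<in> ?I" "cf_map u t = cf_map u' t'" by blast
      then show False using cf_map_inj[OF pl(3,1,2), of t t'] pl(4) by auto
    qed
  qed
  then have "\<forall>p\<in>P. \<exists>c>0. \<forall>x\<in>cf_map (fst p) ` ?I. \<forall>y\<in>cf_map (snd p) ` ?I. c \<le> dist x y" by auto
  from bchoice[OF this] obtain c where "\<forall>p\<in>P. 0 < c p \<and>
      (\<forall>x\<in>cf_map (fst p) ` ?I. \<forall>y\<in>cf_map (snd p) ` ?I. c p \<le> dist x y)" by blast
  then have c: "\<And>p. p \<in> P \<Longrightarrow> 0 < c p"
    "\<And>p x y. p \<in> P \<Longrightarrow> x \<in> cf_map (fst p) ` ?I \<Longrightarrow> y \<in> cf_map (snd p) ` ?I \<Longrightarrow> c p \<le> dist x y"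
    by blast+
  define C where "C = Min (insert 1 (c ` P))"
  have "0 < C" unfolding C_def using \<open>finite P\<close> c(1) by (subst Min_gr_iff) auto
  moreover have "C \<le> \<bar>cf_map u t - cf_map u' t'\<bar>"
    if "\<not> big l" "u \<in> level_words l" "u' \<in> level_words l" "u \<noteq> u'" "t \<in> ?I" "t' \<in> ?I" for l u u' t t'
  proof -
    have p: "(u, u') \<in> P" using that by (auto simp: P_def level_words_def)
    then have "C \<le> c (u, u')" unfolding C_def using \<open>finite P\<close> by (intro Min_le) auto
    also have "\<dots> \<le> dist (cf_map u t) (cf_map u' t')" using c(2)[OF p] that by auto
    finally show ?thesis by (simp add: dist_real_def)
  qed
  ultimately show ?thesis by blast
qed

text \<open>
  The numbers \<open>1 / (b + t)\<close> with \<open>\<beta> \<le> b < 2 \<beta>\<close> are spaced at distances about \<open>1 / \<beta>\<^sup>2\<close>. The remainders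
  differ by at most \<open>1/6\<close>, which costs at most half of the difference \<open>b' - b\<close>.
\<close>
lemma big_words_separated:
  assumes "0 < d" "b' = b + d" "base l \<le> b" "b' < 2 * base l"
    and "t \<in> {1 / 3..1 / 2}" "t' \<in> {1 / 3..1 / 2}"
  shows "real d / (128 * (real (base l))\<^sup>2) \<le> \<bar>cf_map [2, b] t - cf_map [2, b'] t'\<bar>"
proof -
  let ?\<beta> = "real (base l)"
  have \<beta>: "0 < ?\<beta>" using base_pos[of l] by simp
  have b: "?\<beta> \<le> real b" "real b + 1 \<le> real b'" "real b' + 1 \<le> 2 * ?\<beta>" "real b' = real b + real d" "1 \<le> real d"
    using assms by auto
  let ?x = "real b + t" and ?y = "real b' + t'"
  have x: "0 < ?x" "?x \<le> 2 * ?\<beta>" "1 \<le> ?x" and y: "0 < ?y" "?y \<le> 2 * ?\<beta>" "1 \<le> ?y"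
    using assms b base_pos[of l] by auto
  have gap: "real d / 2 \<le> ?y - ?x" using assms b by auto
  have "?x * ?y \<le> (2 * ?\<beta>) * (2 * ?\<beta>)" using x y by (intro mult_mono) auto
  moreover have "0 < ?x * ?y" using x y by simp
  moreover have "0 \<le> ?y - ?x" using gap b(5) by linarith
  ultimately have "(real d / 2) / ((2 * ?\<beta>) * (2 * ?\<beta>)) \<le> (?y - ?x) / (?x * ?y)"
    using gap by (intro frac_le)
  also have "\<dots> = \<bar>1 / ?x - 1 / ?y\<bar>"
    using x y gap b by (simp add: diff_frac_eq)
  finally have inner: "real d / (8 * ?\<beta>\<^sup>2) \<le> \<bar>1 / ?x - 1 / ?y\<bar>"
    by (simp add: power2_eq_square)
  have "real d / (8 * ?\<beta>\<^sup>2) / 16 \<le> \<bar>1 / ?x - 1 / ?y\<bar> / 16"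
    using inner by (rule divide_right_mono) simp
  also have "\<dots> \<le> \<bar>cf_map [2] (1 / ?x) - cf_map [2] (1 / ?y)\<bar>"
    using cf_map_dist_ge[of "[2]" "1 / ?x" "1 / ?y"] x y by simp
  finally show ?thesis by simp
qed

text \<open>
  Let \<open>l\<close> be the first level on which two codes of points of \<open>U\<close> differ, and \<open>q\<close> the denominator of the
  common prefix. If \<open>l\<close> is free, the gap between free words gives \<open>diam U \<ge> c / (4 q\<^sup>2)\<close>, and the mass of
  the prefix is at most \<open>144\<^sup>s q\<^sup>-\<^sup>2\<^sup>s\<close>. If \<open>l\<close> is big and the large quotients that occur range over an
  interval of length \<open>d\<close>, then \<open>diam U\<close> is at least of the order \<open>(d / \<beta>) / (\<beta> q\<^sup>2)\<close>, whereas the mass is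
  at most \<open>2 (d / \<beta>) \<beta>\<^sup>-\<^sup>s q\<^sup>-\<^sup>2\<^sup>s\<close>; since \<open>d \<le> \<beta>\<close> and \<open>s \<le> 1\<close>, the factor \<open>d / \<beta>\<close> is at most its \<open>s\<close>-th power.
\<close>
lemma codes_in_set_small:
  "\<exists>K>0. \<forall>U. bounded U \<longrightarrow>
     (\<exists>D\<in>sets code_measure. {\<omega>\<in>codes. point \<omega> \<in> U} \<subseteq> D \<and> emeasure code_measure D \<le> ennreal (K * diam_pow s U))"
proof -
  obtain c where c: "0 < c" and sep: "\<And>l u u' t t'. \<not> big l \<Longrightarrow> u \<in> level_words l \<Longrightarrow> u' \<in> level_words l \<Longrightarrow> u \<noteq> u' \<Longrightarrow>
     t \<in> {1 / 3..1 / 2} \<Longrightarrow> t' \<in> {1 / 3..1 / 2} \<Longrightarrow> c \<le> \<bar>cf_map u t - cf_map u' t'\<bar>"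
    using free_words_separated by metis
  define K where "K = 144 powr s * (4 / c) powr s + 2 * 512 powr s"
  have K: "0 < K" using c by (auto simp: K_def intro: add_nonneg_pos)
  have "\<exists>D\<in>sets code_measure. {\<omega>\<in>codes. point \<omega> \<in> U} \<subseteq> D \<and> emeasure code_measure D \<le> ennreal (K * diam_pow s U)"
    if U: "bounded U" for U
  proof -
    let ?C = "{\<omega>\<in>codes. point \<omega> \<in> U}"
    consider "?C = {}" | \<omega>0 where "?C = {\<omega>0}" | \<omega>1 \<omega>2 where "\<omega>1 \<in> ?C" "\<omega>2 \<in> ?C" "\<omega>1 \<noteq> \<omega>2" by blast
    then show ?thesis
    proof cases
      case 1
      then show ?thesis by (intro bexI[of _ "{}"]) auto
    next
      case (2 \<omega>0)
      then have "\<omega>0 \<in> codes" by blast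
      then show ?thesis using 2 code_null_set[of \<omega>0] by (intro bexI[of _ "{\<omega>0}"]) simp_all
    next
      case (3 \<omega>1 \<omega>2)
      define split where "split l \<longleftrightarrow> (\<exists>\<omega>\<in>?C. \<exists>\<omega>'\<in>?C. \<omega> l \<noteq> \<omega>' l)" for l
      define l where "l = (LEAST l. split l)"
      have "\<exists>i. \<omega>1 i \<noteq> \<omega>2 i" using 3 by blast
      then have "\<exists>l. split l" unfolding split_def using 3 by blast
      then have "split l" unfolding l_def by (rule LeastI_ex)
      have agree: "\<omega> i = \<omega>1 i" if "\<omega> \<in> ?C" "i < l" for \<omega> i
        using not_less_Least[of i split] that 3 unfolding l_def split_def by blast
      define T where "T = (\<lambda>\<omega>. \<omega> l) ` ?C"
      define v where "v = level_word \<omega>1 l"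
      have \<omega>1: "\<omega>1 \<in> codes" using 3 by auto
      have T: "T \<subseteq> level_words l" by (auto simp: T_def codesD)
      have same: "level_word \<omega> l = v" if "\<omega> \<in> ?C" for \<omega>
        unfolding v_def by (rule level_word_cong) (rule agree[OF that])
      let ?D = "{\<omega>\<in>codes. (\<forall>i<l. \<omega> i = \<omega>1 i) \<and> \<omega> l \<in> T}"
      have D: "?D \<in> sets code_measure" "emeasure code_measure ?D = ennreal (mass \<omega>1 l * (\<Sum>u\<in>T. weight l u))"
        by (rule cylinder[OF \<omega>1 T])+
      have sub: "?C \<subseteq> ?D" using agree by (auto simp: T_def)
      have v: "pos_list v" unfolding v_def by (rule pos_list_level_word[OF \<omega>1])
      let ?q = "real (cden v)" and ?d = "diameter U"
      have q: "0 < ?q" using cden_pos[OF v] by simp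
      have U_ne: "U \<noteq> {}" using 3 by auto
      then have dp: "diam_pow s U = ?d powr s" using s by (simp add: diam_pow_def)
      have d0: "0 \<le> ?d" using U by (rule diameter_ge_0)
      have dist: "\<bar>cf_map (\<omega> l) (tail \<omega> (Suc l)) - cf_map (\<omega>' l) (tail \<omega>' (Suc l))\<bar> / (4 * ?q\<^sup>2) \<le> ?d"
        if "\<omega> \<in> ?C" "\<omega>' \<in> ?C" for \<omega> \<omega>'
      proof -
        have cd: "\<omega> \<in> codes" "\<omega>' \<in> codes" using that by auto
        have "\<bar>tail \<omega> l - tail \<omega>' l\<bar> / (4 * ?q\<^sup>2) \<le> \<bar>cf_map v (tail \<omega> l) - cf_map v (tail \<omega>' l)\<bar>"
          using tail_bounds[OF cd(1), of l] tail_bounds[OF cd(2), of l]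
          by (intro cf_map_dist_ge[OF v]) auto
        also have "\<dots> = dist (point \<omega>) (point \<omega>')"
          using point_eq_tail[OF cd(1), of l] point_eq_tail[OF cd(2), of l] same[OF that(1)] same[OF that(2)]
          by (simp add: dist_real_def)
        also have "\<dots> \<le> ?d" using U that by (intro diameter_bounded_bound) auto
        finally show ?thesis using tail_step[OF cd(1), of l] tail_step[OF cd(2), of l] by simp
      qed
      have tails: "tail \<omega> (Suc l) \<in> {1 / 3..1 / 2}" if "\<omega> \<in> ?C" for \<omega>
        using that tail_bounds[of \<omega> "Suc l"] by auto
      have q_power: "?q powr (- 2 * s) = (1 / ?q\<^sup>2) powr s"
      proof -
        have "1 / ?q\<^sup>2 = ?q powr (- 2)" using q by (simp add: powr_minus_divide)
        then show ?thesis by (simp only: powr_powr)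
      qed
      have "mass \<omega>1 l * (\<Sum>u\<in>T. weight l u) \<le> K * ?d powr s"
      proof (cases "big l")
        case False
        obtain \<omega> \<omega>' where w: "\<omega> \<in> ?C" "\<omega>' \<in> ?C" "\<omega> l \<noteq> \<omega>' l"
          using \<open>split l\<close> unfolding split_def by blast
        have "c \<le> \<bar>cf_map (\<omega> l) (tail \<omega> (Suc l)) - cf_map (\<omega>' l) (tail \<omega>' (Suc l))\<bar>"
          using w tails by (intro sep[OF False]) (auto simp: codesD)
        then have "c / (4 * ?q\<^sup>2) \<le> ?d"
          using dist[OF w(1,2)] q by (meson divide_right_mono order_trans mult_nonneg_nonneg zero_le_numeral zero_le_power2)
        then have "1 / ?q\<^sup>2 \<le> 4 / c * ?d" using c q by (simp add: field_simps)
        then have "(1 / ?q\<^sup>2) powr s \<le> (4 / c * ?d) powr s"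
          using s by (intro powr_mono2) auto
        then have le: "?q powr (- 2 * s) \<le> (4 / c) powr s * ?d powr s"
          by (simp only: q_power powr_mult)
        have "(\<Sum>u\<in>T. weight l u) \<le> (\<Sum>u\<in>level_words l. weight l u)"
          using T by (intro sum_mono2 level_words_finite) (auto simp: weight_nonneg)
        then have "mass \<omega>1 l * (\<Sum>u\<in>T. weight l u) \<le> mass \<omega>1 l * 1"
          unfolding sum_weight by (rule mult_left_mono[OF _ mass_nonneg])
        also have "\<dots> \<le> budget l * ?q powr (- 2 * s)"
          using mass_le[OF \<omega>1, of l] by (simp add: v_def)
        also have "\<dots> \<le> 144 powr s * ((4 / c) powr s * ?d powr s)"
          using budget_le[of l] budget_pos[of l] le by (intro mult_mono) auto
        also have "\<dots> \<le> K * ?d powr s" by (simp add: K_def algebra_simps)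
        finally show ?thesis .
      next
        case True
        let ?\<beta> = "real (base l)"
        have \<beta>: "0 < ?\<beta>" using base_pos[of l] by simp
        define S where "S = {b. [2, b] \<in> T}"
        have T_S: "T = (\<lambda>b. [2, b]) ` S" and S_sub: "S \<subseteq> {base l..<2 * base l}"
          using T True by (auto simp: S_def level_words_def)
        have S_fin: "finite S" using S_sub by (rule finite_subset) simp
        obtain \<omega> \<omega>' where "\<omega> \<in> ?C" "\<omega>' \<in> ?C" "\<omega> l \<noteq> \<omega>' l"
          using \<open>split l\<close> unfolding split_def by blast
        then have "\<exists>b\<in>S. \<exists>b'\<in>S. b \<noteq> b'"
          using T_S by (metis (mono_tags, lifting) T_def image_iff)
        then obtain b b' where bb: "b \<in> S" "b' \<in> S" "b \<noteq> b'" by blast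
        have S_ne: "S \<noteq> {}" using bb by auto
        define d where "d = Max S - Min S"
        have MM: "Min S \<in> S" "Max S \<in> S" using S_fin S_ne by auto
        have "Min S \<noteq> Max S"
          using bb S_fin Min_le[OF S_fin bb(1)] Min_le[OF S_fin bb(2)] Max_ge[OF S_fin bb(1)] Max_ge[OF S_fin bb(2)] by linarith
        moreover have "Min S \<le> Max S" using S_fin MM by simp
        ultimately have d: "0 < d" "Max S = Min S + d" by (auto simp: d_def)
        have range: "base l \<le> Min S" "Max S < 2 * base l" using MM S_sub by auto
        have "S \<subseteq> {Min S..Max S}" using S_fin by auto
        then have "card S \<le> d + 1" using card_mono[of "{Min S..Max S}" S] d by simp
        then have card: "real (card S) \<le> 2 * real d" using d(1) by simp
        have "d \<le> base l" using range d by simp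
        then have x1: "real d / ?\<beta> \<le> 1" using \<beta> by simp
        have x0: "0 < real d / ?\<beta>" using d \<beta> by simp
        have attained: "\<exists>\<omega>\<in>?C. \<omega> l = [2, b]" if "b \<in> S" for b
        proof -
          have "[2, b] \<in> T" using that by (simp only: S_def mem_Collect_eq)
          then show ?thesis unfolding T_def by (rule imageE) (rule bexI, rule sym)
        qed
        obtain \<omega> where w1: "\<omega> \<in> ?C" "\<omega> l = [2, Min S]" using attained[OF MM(1)] by (rule bexE)
        obtain \<omega>' where w2: "\<omega>' \<in> ?C" "\<omega>' l = [2, Max S]" using attained[OF MM(2)] by (rule bexE)
        note w = w1(1) w2(1) w1(2) w2(2)
        have "real d / (128 * ?\<beta>\<^sup>2) \<le> \<bar>cf_map (\<omega> l) (tail \<omega> (Suc l)) - cf_map (\<omega>' l) (tail \<omega>' (Suc l))\<bar>"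
          unfolding w(3,4) using d range tails[OF w(1)] tails[OF w(2)] by (intro big_words_separated) auto
        then have "real d / (128 * ?\<beta>\<^sup>2) / (4 * ?q\<^sup>2) \<le> ?d"
          using dist[OF w(1,2)] q by (meson divide_right_mono order_trans mult_nonneg_nonneg zero_le_numeral zero_le_power2)
        then have diam: "real d / ?\<beta> * (1 / ?\<beta>) * (1 / ?q\<^sup>2) \<le> 512 * ?d"
          using \<beta> q by (simp add: field_simps power2_eq_square)
        have "(\<Sum>u\<in>T. weight l u) = real (card S) * (1 / ?\<beta>)"
          unfolding T_S weight_def using True by (subst sum.reindex) (auto simp: inj_on_def)
        also have "\<dots> \<le> 2 * (real d / ?\<beta>)"
          using card \<beta> by (simp add: divide_right_mono)
        also have "\<dots> \<le> 2 * (real d / ?\<beta>) powr s"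
        proof -
          have "(real d / ?\<beta>) powr 1 \<le> (real d / ?\<beta>) powr s"
            using x0 x1 s by (intro powr_mono') auto
          then show ?thesis using x0 by simp
        qed
        finally have wt: "(\<Sum>u\<in>T. weight l u) \<le> 2 * (real d / ?\<beta>) powr s" .
        have "mass \<omega>1 l \<le> budget l * ?q powr (- 2 * s)"
          using mass_le[OF \<omega>1, of l] by (simp add: v_def)
        also have "\<dots> \<le> ?\<beta> powr (- s) * ?q powr (- 2 * s)"
          using True by (intro mult_right_mono) (auto simp: big_def)
        also have "?\<beta> powr (- s) = (1 / ?\<beta>) powr s"
          using \<beta> by (simp add: powr_minus_divide powr_divide)
        finally have ms: "mass \<omega>1 l \<le> (1 / ?\<beta>) powr s * (1 / ?q\<^sup>2) powr s"
          by (simp only: q_power)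
        have "mass \<omega>1 l * (\<Sum>u\<in>T. weight l u)
            \<le> ((1 / ?\<beta>) powr s * (1 / ?q\<^sup>2) powr s) * (2 * (real d / ?\<beta>) powr s)"
          using ms wt by (intro mult_mono sum_nonneg weight_nonneg) auto
        also have "\<dots> = 2 * (real d / ?\<beta> * (1 / ?\<beta>) * (1 / ?q\<^sup>2)) powr s"
          by (simp only: powr_mult mult_ac)
        also have "\<dots> \<le> 2 * (512 * ?d) powr s"
          using diam s x0 \<beta> by (intro mult_left_mono powr_mono2) auto
        also have "\<dots> = 2 * 512 powr s * ?d powr s" by (simp only: powr_mult mult_ac)
        also have "\<dots> \<le> K * ?d powr s"
          by (intro mult_right_mono) (auto simp: K_def)
        finally show ?thesis .
      qed
      then have "emeasure code_measure ?D \<le> ennreal (K * diam_pow s U)"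
        unfolding D(2) dp by (rule ennreal_leI)
      then show ?thesis using D(1) sub by blast
    qed
  qed
  then show ?thesis using K by blast
qed

text \<open>
  The mass distribution principle: the codes have total mass 1, so in any countable cover by sets of
  diameter at most 1 the gauges sum to at least \<open>1 / K\<close>. For sets this small the \<open>t\<close>-gauge dominates
  the \<open>s\<close>-gauge.
\<close>
lemma hausdorff_outer_measure_large_quotient_set_nonzero:
  assumes "0 \<le> t" "t \<le> s"
  shows "hausdorff_outer_measure t (large_quotient_set B) \<noteq> 0"
proof -
  interpret code: prob_space code_measure by (rule prob_space_code_measure)
  obtain K where K: "0 < K" and small: "\<And>U. bounded U \<Longrightarrow>
     (\<exists>D\<in>sets code_measure. {\<omega>\<in>codes. point \<omega> \<in> U} \<subseteq> D \<and> emeasure code_measure D \<le> ennreal (K * diam_pow s U))"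
    using codes_in_set_small by blast
  have "ennreal (1 / K) \<le> hausdorff_content t 1 (large_quotient_set B)"
    unfolding hausdorff_content_def
  proof (rule Inf_greatest, clarify)
    fix U :: "nat \<Rightarrow> real set"
    assume cover: "large_quotient_set B \<subseteq> (\<Union>i. U i)" and U: "\<forall>i. bounded (U i) \<and> diameter (U i) \<le> 1"
    have "\<forall>i. \<exists>D\<in>sets code_measure. {\<omega>\<in>codes. point \<omega> \<in> U i} \<subseteq> D \<and> emeasure code_measure D \<le> ennreal (K * diam_pow s (U i))"
    proof
      fix i
      show "\<exists>D\<in>sets code_measure. {\<omega>\<in>codes. point \<omega> \<in> U i} \<subseteq> D \<and> emeasure code_measure D \<le> ennreal (K * diam_pow s (U i))"
        by (rule small) (use U in simp)
    qed
    from choice[OF this[unfolded Bex_def]] obtain D where "\<forall>i. D i \<in> sets code_measure \<and>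
        {\<omega>\<in>codes. point \<omega> \<in> U i} \<subseteq> D i \<and> emeasure code_measure (D i) \<le> ennreal (K * diam_pow s (U i))"
      by (rule exE)
    then have D: "\<And>i. D i \<in> sets code_measure" "\<And>i. {\<omega>\<in>codes. point \<omega> \<in> U i} \<subseteq> D i"
      "\<And>i. emeasure code_measure (D i) \<le> ennreal (K * diam_pow s (U i))"
      by simp_all
    have diam: "diam_pow s (U i) \<le> diam_pow t (U i)" for i
    proof -
      have "0 \<le> diameter (U i)" "diameter (U i) \<le> 1" using U diameter_ge_0 by auto
      then have "diameter (U i) powr s \<le> diameter (U i) powr t" if "t \<noteq> 0"
        using assms by (intro powr_mono') auto
      moreover have "diameter (U i) powr s \<le> 1 powr s"
        using \<open>0 \<le> diameter (U i)\<close> \<open>diameter (U i) \<le> 1\<close> s by (intro powr_mono2) auto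
      ultimately show ?thesis using s by (auto simp: diam_pow_def)
    qed
    have "codes \<subseteq> (\<Union>i. D i)"
      using cover point_in_large_quotient_set D(2) by blast
    then have "1 \<le> emeasure code_measure (\<Union>i. D i)"
      using emeasure_mono[of "space code_measure" "\<Union>i. D i" code_measure] D(1) code.emeasure_space_1
      by (simp add: space_code_measure sets.countable_UN)
    also have "\<dots> \<le> (\<Sum>i. emeasure code_measure (D i))"
      using D(1) by (intro emeasure_subadditive_countably) auto
    also have "\<dots> \<le> (\<Sum>i. ennreal K * ennreal (diam_pow t (U i)))"
    proof (rule suminf_le)
      fix i
      have "emeasure code_measure (D i) \<le> ennreal (K * diam_pow s (U i))" by (rule D(3))
      also have "\<dots> \<le> ennreal (K * diam_pow t (U i))"
        using diam K by (intro ennreal_leI mult_left_mono) auto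
      also have "\<dots> = ennreal K * ennreal (diam_pow t (U i))" using K by (simp add: ennreal_mult')
      finally show "emeasure code_measure (D i) \<le> ennreal K * ennreal (diam_pow t (U i))" .
    qed auto
    also have "\<dots> = ennreal K * (\<Sum>i. ennreal (diam_pow t (U i)))" by (rule ennreal_suminf_cmult)
    finally have "ennreal (1 / K) * 1 \<le> ennreal (1 / K) * (ennreal K * (\<Sum>i. ennreal (diam_pow t (U i))))"
      by (rule mult_left_mono) simp
    also have "\<dots> = (\<Sum>i. ennreal (diam_pow t (U i)))"
      using K by (simp add: mult.assoc[symmetric] ennreal_mult'[symmetric])
    finally show "ennreal (1 / K) \<le> (\<Sum>i. ennreal (diam_pow t (U i)))" by simp
  qed
  moreover have "0 < ennreal (1 / K)" using K by simp
  moreover have "hausdorff_content t 1 (large_quotient_set B) \<le> hausdorff_outer_measure t (large_quotient_set B)"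
    unfolding hausdorff_outer_measure_def by (intro SUP_upper) simp
  ultimately show ?thesis by (metis not_less_zero less_le_trans)
qed

end

section \<open>The dimension formula\<close>

text \<open>
  If \<open>P(s) > s log B\<close>, the denominator sum of order \<open>m\<close> outgrows \<open>B\<^sup>s\<^sup>(\<^sup>m\<^sup>+\<^sup>1\<^sup>)\<close> by an exponential factor, which
  swallows the constant \<open>2 \<cdot> 36\<^sup>s\<close>; finitely many tuples already reach the required sum.
\<close>
lemma cantor_scheme_exists:
  fixes B :: real
  assumes "1 < B" "1 / 2 < s" "s \<le> 1" "s * ln B < pressure s"
  shows "\<exists>Z m W. cantor_scheme B s Z m W"
proof -
  obtain c where c: "s * ln B < c" "c < pressure s" using assms(4) dense by blast
  have "eventually (\<lambda>n. c < ln (denom_sum s n) / real n) sequentially"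
    using pressure_limit[OF assms(2)] c by (simp add: order_tendstoD(1))
  moreover have "eventually (\<lambda>n. ln (2 * 36 powr s) + s * (real n + 1) * ln B < c * real n) sequentially"
  proof -
    obtain n0 :: nat where n0: "(ln (2 * 36 powr s) + s * ln B) / (c - s * ln B) < real n0"
      using reals_Archimedean2 by blast
    have "ln (2 * 36 powr s) + s * (real n + 1) * ln B < c * real n" if "n0 \<le> n" for n
    proof -
      have "(ln (2 * 36 powr s) + s * ln B) / (c - s * ln B) < real n" using n0 that by linarith
      then show ?thesis using c by (simp add: field_simps)
    qed
    then show ?thesis unfolding eventually_sequentially by blast
  qed
  ultimately have "eventually (\<lambda>n. c < ln (denom_sum s n) / real n \<and>
      ln (2 * 36 powr s) + s * (real n + 1) * ln B < c * real n \<and> 1 \<le> n) sequentially"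
    using eventually_ge_at_top[of 1] by eventually_elim auto
  then obtain m where m: "c < ln (denom_sum s m) / real m"
    "ln (2 * 36 powr s) + s * (real m + 1) * ln B < c * real m" "1 \<le> m"
    unfolding eventually_sequentially by (meson order_refl)
  define R where "R = 2 * 36 powr s * (B ^ (m + 1)) powr s"
  have R: "0 < R" using assms(1) by (simp add: R_def)
  have "ln R = ln (2 * 36 powr s) + s * (real m + 1) * ln B"
    unfolding R_def using assms(1) by (subst ln_mult) (auto simp: ln_powr ln_realpow ln_mult algebra_simps)
  also have "\<dots> < ln (denom_sum s m)"
    using m by (simp add: field_simps)
  finally have R_less: "R < denom_sum s m"
    using R denom_sum_pos[OF assms(2)] by simp
  have "\<exists>W. finite W \<and> W \<subseteq> pos_tuples m \<and> R < (\<Sum>w\<in>W. real (cden w) powr (- 2 * s))"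
  proof (rule ccontr)
    assume "\<not> ?thesis"
    then have "denom_sum s m \<le> R"
      unfolding denom_sum_def by (intro infsum_le_finite_sums denom_summable assms) (auto simp: not_less)
    then show False using R_less by simp
  qed
  then obtain W where W: "finite W" "W \<subseteq> pos_tuples m" "R < (\<Sum>w\<in>W. real (cden w) powr (- 2 * s))" by blast
  let ?Z = "\<Sum>w\<in>W. real (cden w) powr (- 2 * s)"
  have "R * (B ^ (m + 1)) powr (- s) \<le> ?Z * (B ^ (m + 1)) powr (- s)"
    using W by (intro mult_right_mono) auto
  moreover have "R * (B ^ (m + 1)) powr (- s) = 2 * 36 powr s * ((B ^ (m + 1)) powr s * (B ^ (m + 1)) powr (- s))"
    by (simp add: R_def)
  moreover have "(B ^ (m + 1)) powr s * (B ^ (m + 1)) powr (- s) = 1"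
    using assms(1) by (subst powr_add[symmetric]) simp
  ultimately have "2 * 36 powr s \<le> ?Z * (B ^ (m + 1)) powr (- s)" by (simp only: mult_1_right)
  then have "cantor_scheme B s ?Z m W"
    using assms m W by unfold_locales auto
  then show ?thesis by blast
qed

theorem theorem2:
  fixes B :: real
  assumes "B > 1"
  shows "(\<exists>!\<theta>::real. \<theta> > 1 / 2 \<and> pressure \<theta> = \<theta> * ln B) \<and>
         hausdorff_dim (large_quotient_set B) =
           ereal (THE \<theta>::real. \<theta> > 1 / 2 \<and> pressure \<theta> = \<theta> * ln B)"
proof -
  let ?root = "\<lambda>\<theta>::real. \<theta> > 1 / 2 \<and> pressure \<theta> = \<theta> * ln B"
  let ?A = "large_quotient_set B"
  obtain \<theta> where \<theta>: "1 / 2 < \<theta>" "\<theta> \<le> 1" "pressure \<theta> = \<theta> * ln B"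
    using pressure_root_exists[OF assms] by blast
  have above: "pressure s < s * ln B" if "\<theta> < s" for s
    using pressure_minus_linear_strict_antimono[OF assms \<theta>(1) that] \<theta>(3) by simp
  have below: "s * ln B < pressure s" if "1 / 2 < s" "s < \<theta>" for s
    using pressure_minus_linear_strict_antimono[OF assms that] \<theta>(3) by simp
  have unique: "\<theta>' = \<theta>" if "?root \<theta>'" for \<theta>'
    using above[of \<theta>'] below[of \<theta>'] that by (cases \<theta>' \<theta> rule: linorder_cases) auto
  have ex1: "\<exists>!\<theta>. ?root \<theta>" using \<theta> unique by blast
  have root: "(THE \<theta>. ?root \<theta>) = \<theta>" by (rule the_equality[OF _ unique]) (use \<theta> in simp_all)
  have "hausdorff_dim ?A = ereal \<theta>"
  proof (rule antisym)
    show "hausdorff_dim ?A \<le> ereal \<theta>"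
    proof (rule ereal_le_epsilon2)
      fix e :: real assume e: "0 < e"
      have "hausdorff_outer_measure (\<theta> + e) ?A = 0"
        using \<theta> e above[of "\<theta> + e"] by (intro hausdorff_outer_measure_large_quotient_set_eq_0 assms) auto
      then show "hausdorff_dim ?A \<le> ereal \<theta> + ereal e"
        unfolding hausdorff_dim_def using \<theta> e by (intro Inf_lower) auto
    qed
    show "ereal \<theta> \<le> hausdorff_dim ?A"
      unfolding hausdorff_dim_def
    proof (rule Inf_greatest, clarify)
      fix t :: real assume t: "0 \<le> t" "hausdorff_outer_measure t ?A = 0"
      show "ereal \<theta> \<le> ereal t"
      proof (rule ccontr)
        assume "\<not> ereal \<theta> \<le> ereal t"
        then have "max t (1 / 2) < \<theta>" using \<theta> by simp
        then obtain r where r: "max t (1 / 2) < r" "r < \<theta>" using dense by blast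
        then obtain Z m W where "cantor_scheme B r Z m W"
          using cantor_scheme_exists[OF assms, of r] below[of r] \<theta>(2) by auto
        then have "hausdorff_outer_measure t ?A \<noteq> 0"
          by (rule cantor_scheme.hausdorff_outer_measure_large_quotient_set_nonzero) (use t r in auto)
        then show False using t by simp
      qed
    qed
  qed
  then show ?thesis using ex1 root by simp
qed

end
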